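(* Let $X$ be a completely regular topological space. Then the Riesz space $\mathrm{H}_{nf}(X)$ of nearly finite Hausdorff continuous functions on $X$, together with the embedding $\mathrm{C}(X)\to\mathrm{H}_{nf}(X)$ sending $f$ to $x\mapsto[f(x),f(x)]$, is the universal completion of the Riesz space $\mathrm{C}(X)$ of continuous real functions on $X$.
   Context: Interval-valued functions: $\overline{\mathbb{IR}}$ is the set of nonempty compact intervals $[\underline{a},\overline{a}]$ of $\overline{\mathbb{R}}=[-\infty,+\infty]$, ordered by reverse inclusion $\sqsubseteq$, with its Scott topology, which is generated by the sets $\{\boldsymbol{a}\mid\underline{a}>p\}$ and $\{\boldsymbol{a}\mid\overline{a}<q\}$, $p,q\in\mathbb{Q}$. For $f\colon X\to\overline{\mathbb{IR}}$ write $f(x)=[\underline{f}(x),\overline{f}(x)]$; $f$ is continuous iff $\underline{f}$ is lower semicontinuous and $\overline{f}$ is upper semicontinuous. $\mathrm{C}(X,\overline{\mathbb{IR}})$ is the set of continuous functions, with two partial orders: $f\le g$ iff $\underline{f}\le\underline{g}$ and $\overline{f}\le\overline{g}$ pointwise; and $f\sqsubseteq g$ iff $f(x)\supseteq g(x)$ for all $x$. $f\in\mathrm{C}(X,\overline{\mathbb{IR}})$ is Hausdorff continuous if it is maximal for $\sqsubseteq$, and nearly finite if $\{x\mid\underline{f}(x)\in\mathbb{R}\text{ and }\overline{f}(x)\in\mathbb{R}\}$ is dense in $X$. $\mathrm{H}_{nf}(X)$ is the set of nearly finite Hausdorff continuous functions, ordered by $\le$. Riesz structure on $\mathrm{H}_{nf}(X)$: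 let $\mathfrak{B}(\mathcal{O}X)$ be the complete Boolean algebra of regular open subsets of $X$. For a frame $M$, $\mathrm{C}(M)$ is the Riesz space of frame homomorphisms $\mathfrak{L}(\mathbb{R})\to M$, where $\mathfrak{L}(\mathbb{R})$ is the frame presented by generators $(p,-),(-,p)$ ($p\in\mathbb{Q}$) and relations $(p,-)\wedge(-,q)=0$ if $p\ge q$; $(p,-)\vee(-,q)=1$ if $p<q$; $(p,-)=\bigvee_{q>p}(q,-)$; $(-,p)=\bigvee_{q<p}(-,q)$; $\bigvee_p(p,-)=1=\bigvee_p(-,p)$. It is ordered by $f\le g$ iff $f(p,-)\le g(p,-)$ for all $p$, with $(f+g)(p,-)=\bigvee_{r}f(r,-)\wedge g(p-r,-)$, $(f+g)(-,q)=\bigvee_{s}f(-,s)\wedge g(-,q-s)$, $(-f)(p,-)=f(-,-p)$, $(-f)(-,q)=f(-q,-)$, and for $\lambda>0$ $(\lambda f)(p,-)=\bigvee\{f(r,-)\mid \lambda r>p\}$, $(\lambda f)(-,q)=\bigvee\{f(-,s)\mid\lambda s<q\}$. The map sending $f\in\mathrm{H}_{nf}(X)$ to the homomorphism $(p,-)\mapsto\mathrm{int}\,\mathrm{cl}\{x\mid\underline{f}(x)>p\}$, $(-,q)\mapsto\mathrm{int}\,\mathrm{cl}\{x\mid\overline{f}(x)<q\}$ is an order isomorphism $\mathrm{H}_{nf}(X)\to\mathrm{C}(\mathfrak{B}(\mathcal{O}X))$ (known), and $\mathrm{H}_{nf}(X)$ carries the Riesz space operations $\oplus,\odot$ transported along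 it. $X$ is completely regular iff its frame of open sets is completely regular (points can be separated from closed sets by continuous real functions). A Riesz space is universally complete if it is Dedekind complete (nonempty subsets bounded above have suprema) and laterally complete (every nonempty set of pairwise disjoint positive elements has a supremum). A universal completion of $R$ is a universally complete Riesz space $\mathcal{U}(R)$ with a Riesz space embedding $\mu\colon R\to\mathcal{U}(R)$ such that $f=\bigvee\{\mu(g)\mid g\in R,\ 0\le\mu(g)\le f\}$ for all $f\in\mathcal{U}(R)^+$. *)

theory Defs
  imports
    "HOL-Analysis.Analysis"
    "HOL-Library.Interval"
    "HOL-Algebra.Complete_Lattice"
    "HOL-Algebra.Group"
begin

section \<open>Riesz spaces and universal completions\<close>

record 'a riesz = "'a gorder" +
  vadd :: "'a \<Rightarrow> 'a \<Rightarrow> 'a"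
  vzero :: 'a
  vscale :: "real \<Rightarrow> 'a \<Rightarrow> 'a"

locale riesz_space = lattice R for R :: "('a, 'm) riesz_scheme" (structure) +
  assumes additive_comm_group:
      "comm_group \<lparr>carrier = carrier R, mult = vadd R, one = vzero R\<rparr>"
    and vscale_closed: "x \<in> carrier R \<Longrightarrow> vscale R c x \<in> carrier R"
    and vscale_one: "x \<in> carrier R \<Longrightarrow> vscale R 1 x = x"
    and vscale_vscale: "x \<in> carrier R \<Longrightarrow> vscale R c (vscale R d x) = vscale R (c * d) x"
    and vscale_add_left: "x \<in> carrier R \<Longrightarrow>
      vscale R (c + d) x = vadd R (vscale R c x) (vscale R d x)"
    and vscale_add_right: "\<lbrakk>x \<in> carrier R; y \<in> carrier R\<rbrakk> \<Longrightarrow>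
      vscale R c (vadd R x y) = vadd R (vscale R c x) (vscale R c y)"
    and vadd_mono: "\<lbrakk>x \<in> carrier R; y \<in> carrier R; z \<in> carrier R; x \<sqsubseteq> y\<rbrakk> \<Longrightarrow>
      vadd R x z \<sqsubseteq> vadd R y z"
    and vscale_nonneg: "\<lbrakk>x \<in> carrier R; vzero R \<sqsubseteq> x; 0 \<le> c\<rbrakk> \<Longrightarrow> vzero R \<sqsubseteq> vscale R c x"

definition riesz_abs :: "('a, 'm) riesz_scheme \<Rightarrow> 'a \<Rightarrow> 'a" where
  "riesz_abs R x = x \<squnion>\<^bsub>R\<^esub> vscale R (-1) x"

definition riesz_disjoint :: "('a, 'm) riesz_scheme \<Rightarrow> 'a \<Rightarrow> 'a \<Rightarrow> bool" where
  "riesz_disjoint R x y \<longleftrightarrow> riesz_abs R x \<sqinter>\<^bsub>R\<^esub> riesz_abs R y = vzero R"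

definition dedekind_complete :: "('a, 'm) riesz_scheme \<Rightarrow> bool" where
  "dedekind_complete R \<longleftrightarrow>
     (\<forall>A \<subseteq> carrier R. A \<noteq> {} \<and> Upper R A \<noteq> {} \<longrightarrow> (\<exists>s. is_lub R s A))"

definition laterally_complete :: "('a, 'm) riesz_scheme \<Rightarrow> bool" where
  "laterally_complete R \<longleftrightarrow>
     (\<forall>A \<subseteq> carrier R. A \<noteq> {} \<and> (\<forall>x\<in>A. vzero R \<sqsubseteq>\<^bsub>R\<^esub> x) \<and> pairwise (riesz_disjoint R) A
        \<longrightarrow> (\<exists>s. is_lub R s A))"

definition universally_complete :: "('a, 'm) riesz_scheme \<Rightarrow> bool" where
  "universally_complete R \<longleftrightarrow> riesz_space R \<and> dedekind_complete R \<and> laterally_complete R"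

definition riesz_embedding ::
    "('a, 'm) riesz_scheme \<Rightarrow> ('b, 'n) riesz_scheme \<Rightarrow> ('a \<Rightarrow> 'b) \<Rightarrow> bool" where
  "riesz_embedding R S \<mu> \<longleftrightarrow>
     \<mu> \<in> carrier R \<rightarrow> carrier S \<and> inj_on \<mu> (carrier R) \<and>
     (\<forall>x\<in>carrier R. \<forall>y\<in>carrier R. \<mu> (vadd R x y) = vadd S (\<mu> x) (\<mu> y)) \<and>
     (\<forall>c. \<forall>x\<in>carrier R. \<mu> (vscale R c x) = vscale S c (\<mu> x)) \<and>
     (\<forall>x\<in>carrier R. \<forall>y\<in>carrier R. \<mu> (x \<squnion>\<^bsub>R\<^esub> y) = \<mu> x \<squnion>\<^bsub>S\<^esub> \<mu> y) \<and>
     (\<forall>x\<in>carrier R. \<forall>y\<in>carrier R. \<mu> (x \<sqinter>\<^bsub>R\<^esub> y) = \<mu> x \<sqinter>\<^bsub>S\<^esub> \<mu> y)"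

definition universal_completion ::
    "('a, 'm) riesz_scheme \<Rightarrow> ('b, 'n) riesz_scheme \<Rightarrow> ('a \<Rightarrow> 'b) \<Rightarrow> bool" where
  "universal_completion R U \<mu> \<longleftrightarrow>
     riesz_space R \<and> universally_complete U \<and> riesz_embedding R U \<mu> \<and>
     (\<forall>f\<in>carrier U. vzero U \<sqsubseteq>\<^bsub>U\<^esub> f \<longrightarrow>
        is_lub U f {\<mu> g |g. g \<in> carrier R \<and> vzero U \<sqsubseteq>\<^bsub>U\<^esub> \<mu> g \<and> \<mu> g \<sqsubseteq>\<^bsub>U\<^esub> f})"


section \<open>Frame homomorphisms out of the frame of reals\<close>

text \<open>
  The frame of reals is given by generators \<open>(p,-)\<close>, \<open>(-,q)\<close> and relations. A frame
  homomorphism from it to \<open>M\<close> is, by the meaning of a presentation, an assignment of elements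
  of \<open>M\<close> to the generators that turns the relations into identities of \<open>M\<close>.
  \<open>Above p\<close> stands for \<open>(p,-)\<close> and \<open>Below q\<close> for \<open>(-,q)\<close>.
\<close>

datatype real_gen = Above rat | Below rat

definition real_frame_hom :: "('m, 'k) gorder_scheme \<Rightarrow> (real_gen \<Rightarrow> 'm) \<Rightarrow> bool" where
  "real_frame_hom M f \<longleftrightarrow>
     range f \<subseteq> carrier M \<and>
     (\<forall>p q. q \<le> p \<longrightarrow> f (Above p) \<sqinter>\<^bsub>M\<^esub> f (Below q) = \<bottom>\<^bsub>M\<^esub>) \<and>
     (\<forall>p q. p < q \<longrightarrow> f (Above p) \<squnion>\<^bsub>M\<^esub> f (Below q) = \<top>\<^bsub>M\<^esub>) \<and>
     (\<forall>p. f (Above p) = \<Squnion>\<^bsub>M\<^esub> {f (Above q) |q. p < q}) \<and>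
     (\<forall>p. f (Below p) = \<Squnion>\<^bsub>M\<^esub> {f (Below q) |q. q < p}) \<and>
     \<Squnion>\<^bsub>M\<^esub> {f (Above p) |p. True} = \<top>\<^bsub>M\<^esub> \<and>
     \<Squnion>\<^bsub>M\<^esub> {f (Below p) |p. True} = \<top>\<^bsub>M\<^esub>"

definition hom_add ::
    "('m, 'k) gorder_scheme \<Rightarrow> (real_gen \<Rightarrow> 'm) \<Rightarrow> (real_gen \<Rightarrow> 'm) \<Rightarrow> real_gen \<Rightarrow> 'm" where
  "hom_add M f g = (\<lambda>t. case t of
       Above p \<Rightarrow> \<Squnion>\<^bsub>M\<^esub> {f (Above r) \<sqinter>\<^bsub>M\<^esub> g (Above (p - r)) |r. True}
     | Below q \<Rightarrow> \<Squnion>\<^bsub>M\<^esub> {f (Below s) \<sqinter>\<^bsub>M\<^esub> g (Below (q - s)) |s. True})"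

definition hom_zero :: "('m, 'k) gorder_scheme \<Rightarrow> real_gen \<Rightarrow> 'm" where
  "hom_zero M = (\<lambda>t. case t of
       Above p \<Rightarrow> if p < 0 then \<top>\<^bsub>M\<^esub> else \<bottom>\<^bsub>M\<^esub>
     | Below q \<Rightarrow> if 0 < q then \<top>\<^bsub>M\<^esub> else \<bottom>\<^bsub>M\<^esub>)"

definition hom_minus :: "(real_gen \<Rightarrow> 'm) \<Rightarrow> real_gen \<Rightarrow> 'm" where
  "hom_minus f = (\<lambda>t. case t of Above p \<Rightarrow> f (Below (- p)) | Below q \<Rightarrow> f (Above (- q)))"

definition hom_scale_pos ::
    "('m, 'k) gorder_scheme \<Rightarrow> real \<Rightarrow> (real_gen \<Rightarrow> 'm) \<Rightarrow> real_gen \<Rightarrow> 'm" where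
  "hom_scale_pos M c f = (\<lambda>t. case t of
       Above p \<Rightarrow> \<Squnion>\<^bsub>M\<^esub> {f (Above r) |r. c * of_rat r > of_rat p}
     | Below q \<Rightarrow> \<Squnion>\<^bsub>M\<^esub> {f (Below s) |s. c * of_rat s < of_rat q})"

text \<open>The formula above is for positive scalars; the vector space laws fix the other cases.\<close>

definition hom_scale ::
    "('m, 'k) gorder_scheme \<Rightarrow> real \<Rightarrow> (real_gen \<Rightarrow> 'm) \<Rightarrow> real_gen \<Rightarrow> 'm" where
  "hom_scale M c f =
     (if 0 < c then hom_scale_pos M c f
      else if c = 0 then hom_zero M
      else hom_minus (hom_scale_pos M (- c) f))"

text \<open>These definitions are meant for frames \<open>M\<close>, although they typecheck for any order.\<close>

definition frame_C :: "('m, 'k) gorder_scheme \<Rightarrow> (real_gen \<Rightarrow> 'm) riesz" where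
  "frame_C M = \<lparr>carrier = {f. real_frame_hom M f}, eq = (=),
     le = (\<lambda>f g. \<forall>p. f (Above p) \<sqsubseteq>\<^bsub>M\<^esub> g (Above p)),
     vadd = hom_add M, vzero = hom_zero M, vscale = hom_scale M\<rparr>"

text \<open>The complete Boolean algebra of regular open sets; suprema in it are interiors of
  closures of unions.\<close>

definition regular_opens :: "'a topology \<Rightarrow> 'a set gorder" where
  "regular_opens X =
     \<lparr>carrier = {U. openin X U \<and> X interior_of (X closure_of U) = U}, eq = (=), le = (\<subseteq>)\<rparr>"


section \<open>Interval-valued functions\<close>

text \<open>
  The Scott topology on compact intervals of extended reals. The topological space instance of
  \<^typ>\<open>'a interval\<close> is a different topology. The whole space has to be listed among the
  generators because \<open>[-\<infinity>,\<infinity>]\<close> lies in no other one and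
  \<^const>\<open>topology_generated_by\<close> takes the union of the generators as its space.
\<close>

definition scott_interval :: "ereal interval topology" where
  "scott_interval = topology_generated_by
     (insert UNIV
       (range (\<lambda>p::rat. {a. lower a > ereal (of_rat p)}) \<union>
        range (\<lambda>q::rat. {a. upper a < ereal (of_rat q)})))"

text \<open>Functions on \<open>X\<close> are extensional, so that they are determined by their values on \<open>X\<close>.\<close>

definition interval_maps :: "'a topology \<Rightarrow> ('a \<Rightarrow> ereal interval) set" where
  "interval_maps X = {f \<in> topspace X \<rightarrow>\<^sub>E UNIV. continuous_map X scott_interval f}"

text \<open>\<open>info_le\<close> is the order by reverse inclusion, \<open>ptwise_le\<close> the order by both endpoints.
  The library's order on intervals is inclusion, so neither of the two.\<close>

definition info_le ::
    "'a topology \<Rightarrow> ('a \<Rightarrow> ereal interval) \<Rightarrow> ('a \<Rightarrow> ereal interval) \<Rightarrow> bool" where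
  "info_le X f g \<longleftrightarrow> (\<forall>x\<in>topspace X. set_of (g x) \<subseteq> set_of (f x))"

definition ptwise_le ::
    "'a topology \<Rightarrow> ('a \<Rightarrow> ereal interval) \<Rightarrow> ('a \<Rightarrow> ereal interval) \<Rightarrow> bool" where
  "ptwise_le X f g \<longleftrightarrow>
     (\<forall>x\<in>topspace X. lower (f x) \<le> lower (g x) \<and> upper (f x) \<le> upper (g x))"

definition hausdorff_continuous :: "'a topology \<Rightarrow> ('a \<Rightarrow> ereal interval) \<Rightarrow> bool" where
  "hausdorff_continuous X f \<longleftrightarrow>
     f \<in> interval_maps X \<and> (\<forall>g\<in>interval_maps X. info_le X f g \<longrightarrow> g = f)"

definition nearly_finite :: "'a topology \<Rightarrow> ('a \<Rightarrow> ereal interval) \<Rightarrow> bool" where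
  "nearly_finite X f \<longleftrightarrow>
     X closure_of {x \<in> topspace X. \<bar>lower (f x)\<bar> \<noteq> \<infinity> \<and> \<bar>upper (f x)\<bar> \<noteq> \<infinity>} = topspace X"

definition H_nf :: "'a topology \<Rightarrow> ('a \<Rightarrow> ereal interval) set" where
  "H_nf X = {f. hausdorff_continuous X f \<and> nearly_finite X f}"

definition H_nf_iso :: "'a topology \<Rightarrow> ('a \<Rightarrow> ereal interval) \<Rightarrow> real_gen \<Rightarrow> 'a set" where
  "H_nf_iso X f = (\<lambda>t. case t of
       Above p \<Rightarrow> X interior_of (X closure_of {x \<in> topspace X. lower (f x) > ereal (of_rat p)})
     | Below q \<Rightarrow> X interior_of (X closure_of {x \<in> topspace X. upper (f x) < ereal (of_rat q)}))"

text \<open>The linear structure is transported along \<^const>\<open>H_nf_iso\<close>, which is a bijection from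
  \<open>H_nf X\<close> onto the carrier of \<open>frame_C (regular_opens X)\<close>.\<close>

definition H_nf_riesz :: "'a topology \<Rightarrow> ('a \<Rightarrow> ereal interval) riesz" where
  "H_nf_riesz X =
     (let C = frame_C (regular_opens X); \<phi> = H_nf_iso X; \<psi> = inv_into (H_nf X) (H_nf_iso X) in
      \<lparr>carrier = H_nf X, eq = (=), le = ptwise_le X,
       vadd = (\<lambda>f g. \<psi> (vadd C (\<phi> f) (\<phi> g))),
       vzero = \<psi> (vzero C),
       vscale = (\<lambda>c f. \<psi> (vscale C c (\<phi> f)))\<rparr>)"


section \<open>Continuous real functions\<close>

definition C_riesz :: "'a topology \<Rightarrow> ('a \<Rightarrow> real) riesz" where
  "C_riesz X =
     \<lparr>carrier = {f \<in> topspace X \<rightarrow>\<^sub>E UNIV. continuous_map X euclideanreal f}, eq = (=),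
      le = (\<lambda>f g. \<forall>x\<in>topspace X. f x \<le> g x),
      vadd = (\<lambda>f g. \<lambda>x\<in>topspace X. f x + g x),
      vzero = (\<lambda>x\<in>topspace X. 0),
      vscale = (\<lambda>c f. \<lambda>x\<in>topspace X. c * f x)\<rparr>"

definition C_to_H_nf :: "'a topology \<Rightarrow> ('a \<Rightarrow> real) \<Rightarrow> 'a \<Rightarrow> ereal interval" where
  "C_to_H_nf X f = (\<lambda>x\<in>topspace X. interval_of (ereal (f x)))"

end

theory Submission
  imports Defs
begin

text \<open>
  Up to arbitrarily small errors, a nearly finite
  Hausdorff continuous function \<open>f\<close> agrees with some real function \<open>g\<close> on small open sets lying
  densely in \<open>X\<close>; say that \<open>g\<close> approximates \<open>f\<close>. Such a \<open>g\<close> determines \<open>f\<close>, and every \<open>g\<close> with arbitrarily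
  small oscillation on a dense family of open sets approximates its hull
  \<open>[lsc (usc g), usc (lsc (usc g))]\<close>. The homomorphism of \<open>f\<close> is read off from \<open>g\<close>, and by
  density the frame operations then turn into pointwise operations on approximating functions. So the vector
  lattice laws hold because they hold for real functions. Suprema are hulls of pointwise suprema; for
  a disjoint family, at most one member is positive on a suitable small open set, which keeps
  the hull nearly finite. Complete regularity enters only in the density of \<open>C(X)\<close>, through
  bump functions below \<open>f\<close>.
\<close>

section \<open>Semicontinuous envelopes\<close>

text \<open>Adding intervals end by end does not give the vector space operations: \<open>f\<close>
  plus its negative would be \<open>[lower f - upper f, upper f - lower f]\<close>, which is not
  zero where \<open>f\<close> is not single valued. Restricting to the points where \<open>f\<close>
  is single valued is no remedy: \<open>X\<close> need not be a Baire space, and on the rationals a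
  Hausdorff continuous function can jump at every point. Hence an approximating function is an
  arbitrary real function on all of \<open>X\<close>, and each error \<open>e\<close> has its own
  dense family of open sets; no point is asked to be good for all \<open>e\<close>.

  Maximality enters through one observation: each end of \<open>f\<close> is an envelope of the
  other. So if two Hausdorff continuous functions are not ordered, they are separated by a positive
  gap on a nonempty open set, and inside it a small open set contradicts the corresponding
  inequality of real functions. Since approximations carry errors, strict inequalities between real
  functions are always used with a positive margin, and the errors are fixed fractions of that
  margin.\<close>

definition lsc_on :: "'a topology \<Rightarrow> ('a \<Rightarrow> ereal) \<Rightarrow> bool" where
  "lsc_on X g \<longleftrightarrow> (\<forall>c. openin X {x \<in> topspace X. c < g x})"

definition usc_on :: "'a topology \<Rightarrow> ('a \<Rightarrow> ereal) \<Rightarrow> bool" where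
  "usc_on X g \<longleftrightarrow> (\<forall>c. openin X {x \<in> topspace X. g x < c})"

text \<open>The lower Baire operator. Extended real values make it defined for every
  \<open>g\<close>. Outside \<open>topspace X\<close> the supremum is over the empty set, hence
  \<open>-\<infinity>\<close>.\<close>

definition lsc_env :: "'a topology \<Rightarrow> ('a \<Rightarrow> ereal) \<Rightarrow> 'a \<Rightarrow> ereal" where
  "lsc_env X g x = (SUP U\<in>{U. openin X U \<and> x \<in> U}. INF y\<in>U. g y)"

definition usc_env :: "'a topology \<Rightarrow> ('a \<Rightarrow> ereal) \<Rightarrow> 'a \<Rightarrow> ereal" where
  "usc_env X g x = - lsc_env X (\<lambda>y. - g y) x"

lemma lsc_on_uminus_iff: "lsc_on X (\<lambda>x. - g x) \<longleftrightarrow> usc_on X g"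
  unfolding lsc_on_def usc_on_def by (metis (no_types, lifting) Collect_cong ereal_less_uminus_reorder ereal_uminus_uminus)

lemma lsc_env_le: "x \<in> topspace X \<Longrightarrow> lsc_env X g x \<le> g x"
  unfolding lsc_env_def by (rule SUP_least) (auto intro: INF_lower)

lemma le_lsc_envI:
  assumes "openin X U" "x \<in> U" "\<And>y. y \<in> U \<Longrightarrow> c \<le> g y"
  shows "c \<le> lsc_env X g x"
proof -
  have "c \<le> (INF y\<in>U. g y)" using assms by (intro INF_greatest)
  also have "\<dots> \<le> lsc_env X g x" unfolding lsc_env_def using assms by (intro SUP_upper) auto
  finally show ?thesis .
qed

lemma less_lsc_envE:
  assumes "c < lsc_env X g x"
  obtains U where "openin X U" "x \<in> U" "\<And>y. y \<in> U \<Longrightarrow> c < lsc_env X g y"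
proof -
  obtain U where U: "openin X U" "x \<in> U" "c < (INF y\<in>U. g y)"
    using assms unfolding lsc_env_def less_SUP_iff by auto
  have "c < lsc_env X g y" if "y \<in> U" for y
    using U(3) le_lsc_envI[OF U(1) that, of "INF y\<in>U. g y"] by (meson INF_lower less_le_trans)
  then show ?thesis using that U by blast
qed

lemma lsc_on_lsc_env: "lsc_on X (lsc_env X g)"
  unfolding lsc_on_def
proof
  fix c
  show "openin X {x \<in> topspace X. c < lsc_env X g x}"
  proof (subst openin_subopen, clarify)
    fix x assume "c < lsc_env X g x"
    then obtain U where "openin X U" "x \<in> U" "\<And>y. y \<in> U \<Longrightarrow> c < lsc_env X g y"
      by (rule less_lsc_envE) blast
    then show "\<exists>T. openin X T \<and> x \<in> T \<and> T \<subseteq> {x \<in> topspace X. c < lsc_env X g x}"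
      using openin_subset by blast
  qed
qed

text \<open>For \<open>c < l x\<close> the open set where \<open>c < l\<close> is a neighbourhood of
  \<open>x\<close> on which \<open>g\<close> stays above \<open>c\<close>; density of the order
  turns this into the bound.\<close>

lemma lsc_env_greatest:
  assumes "lsc_on X l" "\<And>y. y \<in> topspace X \<Longrightarrow> l y \<le> g y" "x \<in> topspace X"
  shows "l x \<le> lsc_env X g x"
proof (rule dense_le)
  fix c assume "c < l x"
  then show "c \<le> lsc_env X g x"
    using assms unfolding lsc_on_def
    by (intro le_lsc_envI[of X "{x \<in> topspace X. c < l x}"]) (auto intro: less_imp_le less_le_trans)
qed

lemma lsc_env_mono:
  assumes "\<And>y. y \<in> topspace X \<Longrightarrow> g y \<le> h y" "x \<in> topspace X"
  shows "lsc_env X g x \<le> lsc_env X h x"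
  by (rule lsc_env_greatest[OF lsc_on_lsc_env _ assms(2)]) (meson assms(1) lsc_env_le order_trans)

lemma usc_env_ge: "x \<in> topspace X \<Longrightarrow> g x \<le> usc_env X g x"
  using lsc_env_le[of x X "\<lambda>y. - g y"]
  by (metis ereal_minus_le_minus ereal_uminus_uminus usc_env_def)

lemma usc_env_leI:
  assumes "openin X U" "x \<in> U" "\<And>y. y \<in> U \<Longrightarrow> g y \<le> c"
  shows "usc_env X g x \<le> c"
  using le_lsc_envI[of X U x "-c" "\<lambda>y. - g y"] assms
  by (simp add: usc_env_def ereal_uminus_le_reorder)

lemma usc_on_usc_env: "usc_on X (usc_env X g)"
proof -
  have "lsc_env X (\<lambda>y. - g y) = (\<lambda>x. - usc_env X g x)"
    by (simp add: usc_env_def fun_eq_iff)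
  then show ?thesis using lsc_on_lsc_env[of X "\<lambda>y. - g y"] by (simp add: lsc_on_uminus_iff)
qed

lemma usc_env_least:
  assumes "usc_on X u" "\<And>y. y \<in> topspace X \<Longrightarrow> g y \<le> u y" "x \<in> topspace X"
  shows "usc_env X g x \<le> u x"
  using lsc_env_greatest[of X "\<lambda>y. - u y" "\<lambda>y. - g y" x] assms
  by (simp add: usc_env_def lsc_on_uminus_iff ereal_uminus_le_reorder)

lemma usc_env_mono:
  assumes "\<And>y. y \<in> topspace X \<Longrightarrow> g y \<le> h y" "x \<in> topspace X"
  shows "usc_env X g x \<le> usc_env X h x"
  by (rule usc_env_least[OF usc_on_usc_env _ assms(2)]) (meson assms(1) usc_env_ge order_trans)

lemma openin_Int_greater:
  assumes "openin X W" "lsc_on X l"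
  shows "openin X {x \<in> W. c < l x}"
proof -
  have "{x \<in> W. c < l x} = W \<inter> {x \<in> topspace X. c < l x}"
    using openin_subset[OF assms(1)] by blast
  then show ?thesis using assms by (simp add: lsc_on_def openin_Int)
qed

lemma openin_Int_less:
  assumes "openin X W" "usc_on X u"
  shows "openin X {x \<in> W. u x < c}"
proof -
  have "{x \<in> W. u x < c} = W \<inter> {x \<in> topspace X. u x < c}"
    using openin_subset[OF assms(1)] by blast
  then show ?thesis using assms by (simp add: usc_on_def openin_Int)
qed

text \<open>The Scott topology has rational generators, while the envelopes use all extended real
  levels; a level \<open>c\<close> is the union of the rational levels above it.\<close>

lemma lsc_on_rat:
  assumes "\<And>p::rat. openin X {x \<in> topspace X. ereal (of_rat p) < g x}"
  shows "lsc_on X g"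
  unfolding lsc_on_def
proof
  fix c
  have "{x \<in> topspace X. c < g x} =
    (\<Union>p\<in>{p. c \<le> ereal (of_rat p)}. {x \<in> topspace X. ereal (of_rat p) < g x})" (is "?L = ?R")
  proof
    show "?L \<subseteq> ?R"
    proof clarify
      fix x assume x: "x \<in> topspace X" "c < g x"
      \<comment> \<open>Reals are interposed first because \<open>c\<close> and \<open>g x\<close>
        may be infinite.\<close>
      obtain r s where r: "c < ereal r" "ereal r < ereal s" "ereal s < g x"
        by (metis ereal_dense2 x(2))
      then obtain p where "r < of_rat p" "of_rat p < s"
        using of_rat_dense by auto
      then have "c \<le> ereal (of_rat p)" "ereal (of_rat p) < g x"
        using r by (meson ereal_less_eq(3) less_eq_ereal_def less_ereal.simps(1) order.trans less_trans)+
      then show "x \<in> ?R" using x by blast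
    qed
  qed (auto intro: le_less_trans)
  then show "openin X ?L" using assms by (auto intro: openin_Union)
qed

lemma usc_on_rat:
  assumes "\<And>p::rat. openin X {x \<in> topspace X. g x < ereal (of_rat p)}"
  shows "usc_on X g"
proof -
  have "{x \<in> topspace X. ereal (of_rat p) < - g x} =
      {x \<in> topspace X. g x < ereal (of_rat (-p))}" for p
    by (auto simp: of_rat_minus ereal_less_uminus_reorder)
  then show ?thesis using assms by (subst lsc_on_uminus_iff[symmetric], intro lsc_on_rat) simp
qed

section \<open>Hausdorff continuous functions as hulls\<close>

lemma interval_maps_iff:
  "f \<in> interval_maps X \<longleftrightarrow> f \<in> extensional (topspace X) \<and>
     lsc_on X (\<lambda>x. lower (f x)) \<and> usc_on X (\<lambda>x. upper (f x))"
proof -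
  have "continuous_map X scott_interval f \<longleftrightarrow>
    (\<forall>p::rat. openin X {x \<in> topspace X. ereal (of_rat p) < lower (f x)}) \<and>
    (\<forall>q::rat. openin X {x \<in> topspace X. upper (f x) < ereal (of_rat q)})"
    unfolding scott_interval_def continuous_on_generated_topo_iff Ball_def[symmetric]
    by (simp add: ball_Un vimage_def Int_def conj_commute)
  also have "\<dots> \<longleftrightarrow> lsc_on X (\<lambda>x. lower (f x)) \<and> usc_on X (\<lambda>x. upper (f x))"
  proof (intro iffI conjI)
    assume *: "lsc_on X (\<lambda>x. lower (f x)) \<and> usc_on X (\<lambda>x. upper (f x))"
    then show "\<forall>p::rat. openin X {x \<in> topspace X. ereal (of_rat p) < lower (f x)}"
      "\<forall>q::rat. openin X {x \<in> topspace X. upper (f x) < ereal (of_rat q)}"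
      by (simp_all add: lsc_on_def usc_on_def)
  qed (auto intro: lsc_on_rat usc_on_rat)
  finally show ?thesis by (auto simp: interval_maps_def PiE_def)
qed

text \<open>\<open>Interval (a, b)\<close> has the ends \<open>a\<close> and \<open>b\<close> only
  if \<open>a \<le> b\<close>; this holds here because \<open>usc_env X h\<close> dominates
  \<open>h\<close>. A fourth envelope would give back the lower end.\<close>

definition hc_hull :: "'a topology \<Rightarrow> ('a \<Rightarrow> ereal) \<Rightarrow> 'a \<Rightarrow> ereal interval" where
  "hc_hull X g = (\<lambda>x\<in>topspace X. Interval
     (lsc_env X (usc_env X g) x, usc_env X (lsc_env X (usc_env X g)) x))"

lemma lower_Interval: "a \<le> b \<Longrightarrow> lower (Interval (a, b)) = a"
  by (simp add: lower.rep_eq Interval_inverse)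

lemma upper_Interval: "a \<le> b \<Longrightarrow> upper (Interval (a, b)) = b"
  by (simp add: upper.rep_eq Interval_inverse)

lemma lower_hull: "x \<in> topspace X \<Longrightarrow> lower (hc_hull X g x) = lsc_env X (usc_env X g) x"
  by (simp add: hc_hull_def lower_Interval usc_env_ge)

lemma upper_hull:
  "x \<in> topspace X \<Longrightarrow> upper (hc_hull X g x) = usc_env X (lsc_env X (usc_env X g)) x"
  by (simp add: hc_hull_def upper_Interval usc_env_ge)

lemma lsc_on_cong:
  "(\<And>x. x \<in> topspace X \<Longrightarrow> g x = h x) \<Longrightarrow> lsc_on X g \<longleftrightarrow> lsc_on X h"
  unfolding lsc_on_def by (metis (mono_tags, lifting) Collect_cong)

lemma usc_on_cong:
  "(\<And>x. x \<in> topspace X \<Longrightarrow> g x = h x) \<Longrightarrow> usc_on X g \<longleftrightarrow> usc_on X h"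
  unfolding usc_on_def by (metis (mono_tags, lifting) Collect_cong)

text \<open>The lower end of a refinement is a lower semicontinuous minorant of
  \<open>upper f\<close>, hence below the envelope of \<open>upper f\<close> and so below
  \<open>lower f\<close>. Dually for the upper end, so no refinement is strict.\<close>

lemma hausdorff_continuousI:
  assumes "f \<in> interval_maps X"
    and l: "\<And>x. x \<in> topspace X \<Longrightarrow> lsc_env X (\<lambda>y. upper (f y)) x \<le> lower (f x)"
    and u: "\<And>x. x \<in> topspace X \<Longrightarrow> upper (f x) \<le> usc_env X (\<lambda>y. lower (f y)) x"
  shows "hausdorff_continuous X f"
  unfolding hausdorff_continuous_def
proof (intro conjI ballI impI assms(1))
  fix g assume g: "g \<in> interval_maps X" and le: "info_le X f g"
  have *: "lower (f x) \<le> lower (g x)" "upper (g x) \<le> upper (f x)" if "x \<in> topspace X" for x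
    using le that unfolding info_le_def set_of_eq by auto
  show "g = f"
  proof (rule extensionalityI)
    show "g \<in> extensional (topspace X)" "f \<in> extensional (topspace X)"
      using g assms(1) by (auto simp: interval_maps_iff)
    fix x assume x: "x \<in> topspace X"
    have "lower (g x) \<le> lsc_env X (\<lambda>y. upper (f y)) x"
      using g * x by (intro lsc_env_greatest) (auto simp: interval_maps_iff intro: order_trans[OF lower_le_upper])
    moreover have "usc_env X (\<lambda>y. lower (f y)) x \<le> upper (g x)"
      using g * x by (intro usc_env_least) (auto simp: interval_maps_iff intro: order_trans[OF _ lower_le_upper])
    ultimately show "g x = f x"
      using l[OF x] u[OF x] *[OF x] by (intro interval_eqI) auto
  qed
qed

lemma hausdorff_continuous_hull: "hausdorff_continuous X (hc_hull X g)"
proof (rule hausdorff_continuousI)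
  show "hc_hull X g \<in> interval_maps X"
    unfolding interval_maps_iff
  proof (intro conjI)
    show "hc_hull X g \<in> extensional (topspace X)"
      by (simp add: hc_hull_def)
    show "lsc_on X (\<lambda>x. lower (hc_hull X g x))"
      by (subst lsc_on_cong[OF lower_hull]) (simp_all add: lsc_on_lsc_env)
    show "usc_on X (\<lambda>x. upper (hc_hull X g x))"
      by (subst usc_on_cong[OF upper_hull]) (simp_all add: usc_on_usc_env)
  qed
  fix x assume x: "x \<in> topspace X"
  \<comment> \<open>The third envelope stays below the first, so \<open>lsc_env\<close> of the upper
    end cannot exceed the lower end. The other inequality is built into the hull.\<close>
  have "usc_env X (lsc_env X (usc_env X g)) y \<le> usc_env X g y" if "y \<in> topspace X" for y
    using that by (intro usc_env_least usc_on_usc_env lsc_env_le)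
  then show "lsc_env X (\<lambda>y. upper (hc_hull X g y)) x \<le> lower (hc_hull X g x)"
    unfolding lower_hull[OF x] by (intro lsc_env_mono) (auto simp: upper_hull x)
  show "upper (hc_hull X g x) \<le> usc_env X (\<lambda>y. lower (hc_hull X g y)) x"
    unfolding upper_hull[OF x] by (intro usc_env_mono) (auto simp: lower_hull x)
qed

section \<open>Maximality as a relation between the two ends\<close>

context
  fixes X :: "'a topology" and f :: "'a \<Rightarrow> ereal interval"
  assumes hc: "hausdorff_continuous X f"
begin

lemma hc_extensional: "f \<in> extensional (topspace X)"
  and hc_lsc: "lsc_on X (\<lambda>x. lower (f x))"
  and hc_usc: "usc_on X (\<lambda>x. upper (f x))"
  using hc by (auto simp: hausdorff_continuous_def interval_maps_iff)

text \<open>The hull of \<open>upper f\<close> refines \<open>f\<close>: \<open>upper f\<close> is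
  its own upper envelope, and \<open>lower f\<close> is a lower semicontinuous minorant of it.
  Maximality leaves only equality.\<close>

lemma hc_eq_hull: "f = hc_hull X (\<lambda>x. upper (f x))"
proof -
  have us: "usc_env X (\<lambda>x. upper (f x)) x = upper (f x)" if "x \<in> topspace X" for x
    using that by (intro antisym usc_env_ge usc_env_least hc_usc) auto
  have "info_le X f (hc_hull X (\<lambda>x. upper (f x)))"
    unfolding info_le_def
  proof
    fix x assume x: "x \<in> topspace X"
    have "lower (f x) \<le> lower (hc_hull X (\<lambda>x. upper (f x)) x)"
      unfolding lower_hull[OF x] using us x by (intro lsc_env_greatest hc_lsc) auto
    moreover have "upper (hc_hull X (\<lambda>x. upper (f x)) x) \<le> upper (f x)"
      unfolding upper_hull[OF x] using x by (intro usc_env_least hc_usc) (use us lsc_env_le in \<open>metis+\<close>)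
    ultimately show "set_of (hc_hull X (\<lambda>x. upper (f x)) x) \<subseteq> set_of (f x)"
      unfolding set_of_eq by auto
  qed
  then show ?thesis
    using hc hausdorff_continuous_hull[of X "\<lambda>x. upper (f x)"]
    unfolding hausdorff_continuous_def by metis
qed

text \<open>With \<open>hc_upper\<close> this is the working form of maximality.\<close>

lemma hc_lower: "x \<in> topspace X \<Longrightarrow> lower (f x) = lsc_env X (\<lambda>y. upper (f y)) x"
proof -
  assume x: "x \<in> topspace X"
  have "lower (f x) = lsc_env X (usc_env X (\<lambda>y. upper (f y))) x"
    by (subst hc_eq_hull) (rule lower_hull[OF x])
  also have "\<dots> = lsc_env X (\<lambda>y. upper (f y)) x"
    using x by (intro antisym lsc_env_mono usc_env_least hc_usc usc_env_ge) auto
  finally show ?thesis .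
qed

lemma hc_upper: "x \<in> topspace X \<Longrightarrow> upper (f x) = usc_env X (\<lambda>y. lower (f y)) x"
proof -
  assume x: "x \<in> topspace X"
  have "upper (f x) = usc_env X (lsc_env X (usc_env X (\<lambda>y. upper (f y)))) x"
    by (subst hc_eq_hull) (rule upper_hull[OF x])
  also have "\<dots> = usc_env X (\<lambda>y. lower (f y)) x"
  proof -
    have "lsc_env X (usc_env X (\<lambda>y. upper (f y))) y = lower (f y)" if "y \<in> topspace X" for y
      by (subst (2) hc_eq_hull) (rule lower_hull[OF that, symmetric])
    then show ?thesis using x by (intro antisym usc_env_mono) auto
  qed
  finally show ?thesis .
qed

text \<open>Mostly used in contrapositive form: if \<open>upper f\<close> exceeds \<open>c\<close>
  somewhere in \<open>W\<close>, then so does \<open>lower f\<close>, and for the lower end this is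
  an open condition.\<close>

lemma hc_upper_le_on_open:
  assumes "openin X W" "\<And>x. x \<in> W \<Longrightarrow> lower (f x) \<le> c" "x \<in> W"
  shows "upper (f x) \<le> c"
  using assms hc_upper[of x] usc_env_leI[of X W x "\<lambda>y. lower (f y)"] openin_subset by fastforce

lemma hc_lower_ge_on_open:
  assumes "openin X W" "\<And>x. x \<in> W \<Longrightarrow> c \<le> upper (f x)" "x \<in> W"
  shows "c \<le> lower (f x)"
  using assms hc_lower[of x] le_lsc_envI[of X W x c "\<lambda>y. upper (f y)"] openin_subset by fastforce

text \<open>Envelopes are monotone, and \<open>hc_lower\<close> and \<open>hc_upper\<close> identify
  those of \<open>f\<close>. Together with \<open>hc_le_hull\<close> this makes hulls of pointwise
  suprema least upper bounds.\<close>

lemma hull_le_hc: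
  assumes "\<And>x. x \<in> topspace X \<Longrightarrow> g x \<le> upper (f x)"
  shows "ptwise_le X (hc_hull X g) f"
proof -
  have "usc_env X g x \<le> upper (f x)" if "x \<in> topspace X" for x
    using that assms by (intro usc_env_least hc_usc)
  then have l: "lsc_env X (usc_env X g) x \<le> lower (f x)" if "x \<in> topspace X" for x
    unfolding hc_lower[OF that] using that by (intro lsc_env_mono)
  then have "usc_env X (lsc_env X (usc_env X g)) x \<le> upper (f x)" if "x \<in> topspace X" for x
    unfolding hc_upper[OF that] using that by (intro usc_env_mono)
  with l show ?thesis by (simp add: ptwise_le_def lower_hull upper_hull)
qed

lemma hc_le_hull:
  assumes "\<And>x. x \<in> topspace X \<Longrightarrow> lower (f x) \<le> g x"
  shows "ptwise_le X f (hc_hull X g)"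
proof -
  have "upper (f x) \<le> usc_env X g x" if "x \<in> topspace X" for x
    unfolding hc_upper[OF that] using that assms by (intro usc_env_mono)
  then have l: "lower (f x) \<le> lsc_env X (usc_env X g) x" if "x \<in> topspace X" for x
    unfolding hc_lower[OF that] using that by (intro lsc_env_mono)
  then have "upper (f x) \<le> usc_env X (lsc_env X (usc_env X g)) x" if "x \<in> topspace X" for x
    unfolding hc_upper[OF that] using that by (intro usc_env_mono)
  with l show ?thesis by (simp add: ptwise_le_def lower_hull upper_hull)
qed

end

text \<open>An envelope at \<open>x\<close> sees \<open>g\<close> only near \<open>x\<close>, so
  wild values of \<open>g\<close> elsewhere do no harm.\<close>

lemma hull_le_on_open:
  assumes "openin X W" "\<And>x. x \<in> W \<Longrightarrow> g x \<le> c" "x \<in> W"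
  shows "upper (hc_hull X g x) \<le> c"
proof (rule hc_upper_le_on_open[OF hausdorff_continuous_hull assms(1) _ assms(3)])
  fix y assume y: "y \<in> W"
  then have "y \<in> topspace X" using assms(1) openin_subset by blast
  then show "lower (hc_hull X g y) \<le> c"
    using usc_env_leI[of X W y g c] assms(1,2) y lsc_env_le[of y X "usc_env X g"]
    by (simp add: lower_hull)
qed

lemma hull_ge_on_open:
  assumes "openin X W" "\<And>x. x \<in> W \<Longrightarrow> c \<le> g x" "x \<in> W"
  shows "c \<le> lower (hc_hull X g x)"
proof -
  have W: "W \<subseteq> topspace X" using assms(1) openin_subset by blast
  have "c \<le> lsc_env X (usc_env X g) x"
    using assms W by (intro le_lsc_envI[OF assms(1,3)]) (meson order_trans subsetD usc_env_ge)
  then show ?thesis using W assms(3) by (simp add: lower_hull subsetD)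
qed

lemma ptwise_le_if_lower_le:
  assumes "hausdorff_continuous X f" "hausdorff_continuous X g"
    and "\<And>x. x \<in> topspace X \<Longrightarrow> lower (f x) \<le> lower (g x)"
  shows "ptwise_le X f g"
  using assms(3) unfolding ptwise_le_def
  by (simp add: hc_upper[OF assms(1)] hc_upper[OF assms(2)] usc_env_mono)

lemma ptwise_le_antisym:
  assumes "hausdorff_continuous X f" "hausdorff_continuous X g" "ptwise_le X f g" "ptwise_le X g f"
  shows "f = g"
  using assms(3,4) hc_extensional[OF assms(1)] hc_extensional[OF assms(2)] unfolding ptwise_le_def
  by (intro extensionalityI[of f "topspace X" g]) (simp_all add: interval_eq_iff order.antisym)

lemma ptwise_le_trans: "ptwise_le X f g \<Longrightarrow> ptwise_le X g h \<Longrightarrow> ptwise_le X f h"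
  unfolding ptwise_le_def by (meson order_trans)

section \<open>Approximation of nearly finite functions by real functions\<close>

definition densely :: "'a topology \<Rightarrow> ('a set \<Rightarrow> bool) \<Rightarrow> bool" where
  "densely X P \<longleftrightarrow>
     (\<forall>W. openin X W \<and> W \<noteq> {} \<longrightarrow> (\<exists>V. V \<subseteq> W \<and> openin X V \<and> V \<noteq> {} \<and> P V))"

lemma denselyE:
  assumes "densely X P" "openin X W" "W \<noteq> {}"
  obtains V where "V \<subseteq> W" "openin X V" "V \<noteq> {}" "P V"
  using assms unfolding densely_def by blast

lemma densely_mono: "densely X P \<Longrightarrow> (\<And>V. P V \<Longrightarrow> Q V) \<Longrightarrow> densely X Q"
  unfolding densely_def by meson

text \<open>A set with \<open>P\<close> is shrunk to one with \<open>Q\<close>; heredity of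
  \<open>P\<close> keeps the first property.\<close>

lemma densely_conj:
  assumes "densely X P" "densely X Q" "\<And>V W. P W \<Longrightarrow> V \<subseteq> W \<Longrightarrow> P V"
  shows "densely X (\<lambda>V. P V \<and> Q V)"
  using assms unfolding densely_def by (metis order_trans)

definition tame :: "'a topology \<Rightarrow> ('a \<Rightarrow> real) \<Rightarrow> bool" where
  "tame X g \<longleftrightarrow> (\<forall>e>0. densely X (\<lambda>V. \<exists>a. \<forall>x\<in>V. \<bar>g x - a\<bar> \<le> e))"

definition approximates :: "'a topology \<Rightarrow> ('a \<Rightarrow> real) \<Rightarrow> ('a \<Rightarrow> ereal interval) \<Rightarrow> bool" where
  "approximates X g f \<longleftrightarrow> f \<in> H_nf X \<and> (\<forall>e>0. densely X (\<lambda>V. \<exists>a. \<forall>x\<in>V.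
     \<bar>g x - a\<bar> \<le> e \<and> ereal (a - e) \<le> lower (f x) \<and> upper (f x) \<le> ereal (a + e)))"

lemma approximates_H_nf: "approximates X g f \<Longrightarrow> f \<in> H_nf X"
  by (simp add: approximates_def)

lemma approximatesD:
  "approximates X g f \<Longrightarrow> 0 < e \<Longrightarrow> densely X (\<lambda>V. \<exists>a. \<forall>x\<in>V.
     \<bar>g x - a\<bar> \<le> e \<and> ereal (a - e) \<le> lower (f x) \<and> upper (f x) \<le> ereal (a + e))"
  by (simp add: approximates_def)

lemma approximates_imp_tame: "approximates X g f \<Longrightarrow> tame X g"
  unfolding tame_def by (intro allI impI, drule approximatesD, assumption, erule densely_mono) blast

lemma densely_tame2:
  assumes "tame X g" "tame X h" "0 < e"
  shows "densely X (\<lambda>V. \<exists>a b. \<forall>x\<in>V. \<bar>g x - a\<bar> \<le> e \<and> \<bar>h x - b\<bar> \<le> e)"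
  by (rule densely_mono[OF densely_conj[OF assms(1,2)[unfolded tame_def, rule_format, OF assms(3)]]])
     blast+

lemma tame_add:
  assumes "tame X g" "tame X h"
  shows "tame X (\<lambda>x. g x + h x)"
  unfolding tame_def
proof (intro allI impI)
  fix e :: real assume "0 < e"
  then show "densely X (\<lambda>V. \<exists>a. \<forall>x\<in>V. \<bar>g x + h x - a\<bar> \<le> e)"
  proof (intro densely_mono[OF densely_tame2[OF assms, of "e/2"]]; clarsimp)
    fix V a b assume *: "\<forall>x\<in>V. \<bar>g x - a\<bar> * 2 \<le> e \<and> \<bar>h x - b\<bar> * 2 \<le> e"
    have "\<bar>g x + h x - (a + b)\<bar> \<le> e" if "x \<in> V" for x
      using *[rule_format, OF that] by (simp add: abs_le_iff abs_if split: if_splits)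
    then show "\<exists>c. \<forall>x\<in>V. \<bar>g x + h x - c\<bar> \<le> e" by blast
  qed
qed

lemma tame_scale:
  assumes "tame X g"
  shows "tame X (\<lambda>x. c * g x)"
  unfolding tame_def
proof (intro allI impI)
  fix e :: real assume e: "0 < e"
  \<comment> \<open>The summand 1 keeps the denominator positive when \<open>c = 0\<close>.\<close>
  let ?d = "e / (1 + \<bar>c\<bar>)"
  have d: "0 < ?d" using e by (simp add: add_pos_nonneg)
  have "?d + \<bar>c\<bar> * ?d = ?d * (1 + \<bar>c\<bar>)" by (simp only: distrib_left mult_1_right mult.commute[of "\<bar>c\<bar>"])
  also have "\<dots> = e" using abs_ge_zero[of c] by simp
  finally have de: "?d + \<bar>c\<bar> * ?d = e" .
  show "densely X (\<lambda>V. \<exists>a. \<forall>x\<in>V. \<bar>c * g x - a\<bar> \<le> e)"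
  proof (rule densely_mono[OF assms[unfolded tame_def, rule_format, OF d]])
    fix V assume "\<exists>a. \<forall>x\<in>V. \<bar>g x - a\<bar> \<le> ?d"
    then obtain a where a: "\<And>x. x \<in> V \<Longrightarrow> \<bar>g x - a\<bar> \<le> ?d" by blast
    have "\<bar>c * g x - c * a\<bar> \<le> e" if "x \<in> V" for x
    proof -
      have "\<bar>c * g x - c * a\<bar> = \<bar>c\<bar> * \<bar>g x - a\<bar>"
        by (metis abs_mult right_diff_distrib)
      also have "\<dots> \<le> \<bar>c\<bar> * ?d" using a[OF that] by (intro mult_left_mono) auto
      also have "\<dots> \<le> e" using de d by linarith
      finally show ?thesis .
    qed
    then show "\<exists>a. \<forall>x\<in>V. \<bar>c * g x - a\<bar> \<le> e" by blast
  qed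
qed

lemma tame_const: "tame X (\<lambda>x. c)"
  unfolding tame_def densely_def by (metis abs_zero diff_self less_imp_le order_refl)

text \<open>Since \<open>lower \<le> upper\<close>, finiteness of both ends amounts to excluding one
  infinity at each end. Testing density on nonempty open sets matches
  \<open>densely\<close>.\<close>

lemma H_nf_iff:
  "f \<in> H_nf X \<longleftrightarrow> hausdorff_continuous X f \<and>
     (\<forall>W. openin X W \<and> W \<noteq> {} \<longrightarrow> (\<exists>x\<in>W. lower (f x) \<noteq> -\<infinity> \<and> upper (f x) \<noteq> \<infinity>))"
proof -
  have "\<bar>lower (f x)\<bar> \<noteq> \<infinity> \<and> \<bar>upper (f x)\<bar> \<noteq> \<infinity> \<longleftrightarrow> lower (f x) \<noteq> -\<infinity> \<and> upper (f x) \<noteq> \<infinity>" for x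
    using lower_le_upper[of "f x"] by (cases "lower (f x)"; cases "upper (f x)") auto
  then have *: "nearly_finite X f \<longleftrightarrow> (\<forall>T. openin X T \<and> T \<noteq> {} \<longrightarrow>
      {x \<in> topspace X. lower (f x) \<noteq> -\<infinity> \<and> upper (f x) \<noteq> \<infinity>} \<inter> T \<noteq> {})"
    unfolding nearly_finite_def dense_intersects_open by presburger
  show ?thesis
  proof (intro iffI conjI allI impI; (elim conjE)?)
    assume f: "f \<in> H_nf X"
    then show "hausdorff_continuous X f" by (simp add: H_nf_def)
    fix W assume "openin X W" "W \<noteq> {}"
    with f have "{x \<in> topspace X. lower (f x) \<noteq> -\<infinity> \<and> upper (f x) \<noteq> \<infinity>} \<inter> W \<noteq> {}"
      unfolding H_nf_def mem_Collect_eq * by simp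
    then show "\<exists>x\<in>W. lower (f x) \<noteq> -\<infinity> \<and> upper (f x) \<noteq> \<infinity>" by blast
  next
    assume "hausdorff_continuous X f" and
      W: "\<forall>W. openin X W \<and> W \<noteq> {} \<longrightarrow> (\<exists>x\<in>W. lower (f x) \<noteq> -\<infinity> \<and> upper (f x) \<noteq> \<infinity>)"
    moreover have "{x \<in> topspace X. lower (f x) \<noteq> -\<infinity> \<and> upper (f x) \<noteq> \<infinity>} \<inter> T \<noteq> {}"
      if "openin X T" "T \<noteq> {}" for T
      using W[rule_format, OF conjI[OF that]] openin_subset[OF that(1)] by blast
    ultimately show "f \<in> H_nf X"
      unfolding H_nf_def mem_Collect_eq * by simp
  qed
qed

lemma H_nf_hc: "f \<in> H_nf X \<Longrightarrow> hausdorff_continuous X f"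
  by (simp add: H_nf_iff)

text \<open>The lower end of \<open>f\<close> is above \<open>-\<infinity>\<close> on an open set;
  near finiteness of \<open>h\<close> is applied inside that set, so that both bounds hold at one
  point.\<close>

lemma H_nf_between:
  assumes "f \<in> H_nf X" "h \<in> H_nf X" "hausdorff_continuous X k" "ptwise_le X f k" "ptwise_le X k h"
  shows "k \<in> H_nf X"
  unfolding H_nf_iff
proof (intro conjI allI impI assms(3); elim conjE)
  fix W assume W: "openin X W" "W \<noteq> {}"
  obtain x where x: "x \<in> W" "lower (f x) \<noteq> -\<infinity>"
    using assms(1) W unfolding H_nf_iff by blast
  let ?W = "{y \<in> W. -\<infinity> < lower (f y)}"
  have "openin X ?W" "?W \<noteq> {}"
    using x openin_Int_greater[OF W(1) hc_lsc[OF H_nf_hc[OF assms(1)]], of "-\<infinity>"] by auto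
  then obtain y where y: "y \<in> ?W" "upper (h y) \<noteq> \<infinity>"
    using assms(2) unfolding H_nf_iff by blast
  moreover have "y \<in> topspace X" using y W openin_subset by blast
  ultimately have "-\<infinity> < lower (k y)" "upper (k y) < \<infinity>"
    using assms(4,5) unfolding ptwise_le_def by (fastforce intro: less_le_trans le_less_trans)+
  then show "\<exists>x\<in>W. lower (k x) \<noteq> -\<infinity> \<and> upper (k x) \<noteq> \<infinity>" using y by (intro bexI[of _ y]) auto
qed

text \<open>\<open>real_of_ereal\<close> sends infinite values to 0. This is harmless, because on
  the chosen sets both ends of \<open>f\<close> are trapped within \<open>e\<close> of a real
  \<open>a\<close>.\<close>

lemma approximates_real_lower:
  assumes "f \<in> H_nf X"
  shows "approximates X (\<lambda>x. real_of_ereal (lower (f x))) f"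
  unfolding approximates_def densely_def
proof (intro conjI allI impI assms; elim conjE)
  fix e :: real and W assume e: "0 < e" and W: "openin X W" "W \<noteq> {}"
  note hc = H_nf_hc[OF assms]
  obtain x where x: "x \<in> W" "lower (f x) \<noteq> -\<infinity>" "upper (f x) \<noteq> \<infinity>"
    using assms W unfolding H_nf_iff by blast
  then obtain a where a: "lower (f x) = ereal a"
    using lower_le_upper[of "f x"] by (cases "lower (f x)"; cases "upper (f x)") auto
  let ?U = "{y \<in> W. ereal (a - e) < lower (f y)}"
  have U: "openin X ?U" "x \<in> ?U"
    using openin_Int_greater[OF W(1) hc_lsc[OF hc]] x a e by auto
  \<comment> \<open>If \<open>upper f\<close> were at least \<open>a + e\<close> on all of
    \<open>?U\<close>, then so would be \<open>lower f\<close>, but \<open>lower f x\<close> is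
    \<open>a\<close>.\<close>
  obtain y where y: "y \<in> ?U" "upper (f y) < ereal (a + e)"
    using hc_lower_ge_on_open[OF hc U(1) _ U(2), of "ereal (a + e)"] a e by force
  let ?V = "{y \<in> ?U. upper (f y) < ereal (a + e)}"
  have "openin X ?V" "?V \<noteq> {}" "?V \<subseteq> W"
    using openin_Int_less[OF U(1) hc_usc[OF hc]] y by auto
  moreover have "\<bar>real_of_ereal (lower (f z)) - a\<bar> \<le> e \<and>
      ereal (a - e) \<le> lower (f z) \<and> upper (f z) \<le> ereal (a + e)" if "z \<in> ?V" for z
    using that lower_le_upper[of "f z"]
    by (cases "lower (f z)"; cases "upper (f z)") auto
  ultimately show "\<exists>V\<subseteq>W. openin X V \<and> V \<noteq> {} \<and>
     (\<exists>a. \<forall>x\<in>V. \<bar>real_of_ereal (lower (f x)) - a\<bar> \<le> e \<and>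
        ereal (a - e) \<le> lower (f x) \<and> upper (f x) \<le> ereal (a + e))" by blast
qed

lemma approximates_hc_hull:
  assumes "tame X g"
  shows "approximates X g (hc_hull X (\<lambda>x. ereal (g x)))"
proof -
  let ?f = "hc_hull X (\<lambda>x. ereal (g x))"
  have d: "densely X (\<lambda>V. \<exists>a. \<forall>x\<in>V.
     \<bar>g x - a\<bar> \<le> e \<and> ereal (a - e) \<le> lower (?f x) \<and> upper (?f x) \<le> ereal (a + e))" if "0 < e" for e
    unfolding densely_def
  proof (intro allI impI; elim conjE)
    fix W assume W: "openin X W" "W \<noteq> {}"
    have "densely X (\<lambda>V. \<exists>a. \<forall>x\<in>V. \<bar>g x - a\<bar> \<le> e)"
      using assms that unfolding tame_def by blast
    from this W obtain V where V: "V \<subseteq> W" "openin X V" "V \<noteq> {}"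
      and "\<exists>a. \<forall>x\<in>V. \<bar>g x - a\<bar> \<le> e"
      by (rule denselyE)
    then obtain a where a: "\<And>x. x \<in> V \<Longrightarrow> \<bar>g x - a\<bar> \<le> e"
      by blast
    have "ereal (a - e) \<le> ereal (g x)" "ereal (g x) \<le> ereal (a + e)" if "x \<in> V" for x
      using a[OF that] by auto
    then have "ereal (a - e) \<le> lower (?f x) \<and> upper (?f x) \<le> ereal (a + e)" if "x \<in> V" for x
      using hull_ge_on_open[OF V(2) _ that] hull_le_on_open[OF V(2) _ that] by meson
    with V a show "\<exists>V\<subseteq>W. openin X V \<and> V \<noteq> {} \<and> (\<exists>a. \<forall>x\<in>V.
      \<bar>g x - a\<bar> \<le> e \<and> ereal (a - e) \<le> lower (?f x) \<and> upper (?f x) \<le> ereal (a + e))" by blast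
  qed
  have "?f \<in> H_nf X"
    unfolding H_nf_iff
  proof (intro conjI allI impI hausdorff_continuous_hull; elim conjE)
    fix W assume "openin X W" "W \<noteq> {}"
    with d[OF zero_less_one] obtain V where V: "V \<subseteq> W" "V \<noteq> {}" and
      "\<exists>a. \<forall>x\<in>V. \<bar>g x - a\<bar> \<le> 1 \<and> ereal (a - 1) \<le> lower (?f x) \<and> upper (?f x) \<le> ereal (a + 1)"
      by (rule denselyE)
    then obtain a x where "x \<in> V" "ereal (a - 1) \<le> lower (?f x)" "upper (?f x) \<le> ereal (a + 1)"
      by blast
    with V show "\<exists>x\<in>W. lower (?f x) \<noteq> -\<infinity> \<and> upper (?f x) \<noteq> \<infinity>"
      by (intro bexI[of _ x]) auto
  qed
  with d show ?thesis by (simp add: approximates_def)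
qed

lemma approximatesE:
  assumes "approximates X g f" "0 < e" "openin X W" "W \<noteq> {}"
  obtains V a where "V \<subseteq> W" "openin X V" "V \<noteq> {}" "\<And>x. x \<in> V \<Longrightarrow> \<bar>g x - a\<bar> \<le> e"
    "\<And>x. x \<in> V \<Longrightarrow> ereal (a - e) \<le> lower (f x)" "\<And>x. x \<in> V \<Longrightarrow> upper (f x) \<le> ereal (a + e)"
proof -
  obtain V where V: "V \<subseteq> W" "openin X V" "V \<noteq> {}" "\<exists>a. \<forall>x\<in>V.
      \<bar>g x - a\<bar> \<le> e \<and> ereal (a - e) \<le> lower (f x) \<and> upper (f x) \<le> ereal (a + e)"
    by (rule denselyE[OF approximatesD[OF assms(1,2)] assms(3,4)])
  then obtain a where "\<forall>x\<in>V.
      \<bar>g x - a\<bar> \<le> e \<and> ereal (a - e) \<le> lower (f x) \<and> upper (f x) \<le> ereal (a + e)" by blast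
  with V(1-3) show thesis by (intro that[of V a]) simp_all
qed

lemma approximates2E:
  assumes "approximates X g f" "approximates X g' f'" "0 < e" "openin X W" "W \<noteq> {}"
  obtains V a b where "V \<subseteq> W" "openin X V" "V \<noteq> {}" "\<And>x. x \<in> V \<Longrightarrow> \<bar>g x - a\<bar> \<le> e"
    "\<And>x. x \<in> V \<Longrightarrow> ereal (a - e) \<le> lower (f x)" "\<And>x. x \<in> V \<Longrightarrow> upper (f x) \<le> ereal (a + e)"
    "\<And>x. x \<in> V \<Longrightarrow> \<bar>g' x - b\<bar> \<le> e"
    "\<And>x. x \<in> V \<Longrightarrow> ereal (b - e) \<le> lower (f' x)" "\<And>x. x \<in> V \<Longrightarrow> upper (f' x) \<le> ereal (b + e)"
proof -
  obtain U a where U: "U \<subseteq> W" "openin X U" "U \<noteq> {}" and a: "\<And>x. x \<in> U \<Longrightarrow> \<bar>g x - a\<bar> \<le> e"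
    "\<And>x. x \<in> U \<Longrightarrow> ereal (a - e) \<le> lower (f x)" "\<And>x. x \<in> U \<Longrightarrow> upper (f x) \<le> ereal (a + e)"
    by (rule approximatesE[OF assms(1,3-5)]) blast
  obtain V b where V: "V \<subseteq> U" "openin X V" "V \<noteq> {}" and b: "\<And>x. x \<in> V \<Longrightarrow> \<bar>g' x - b\<bar> \<le> e"
    "\<And>x. x \<in> V \<Longrightarrow> ereal (b - e) \<le> lower (f' x)" "\<And>x. x \<in> V \<Longrightarrow> upper (f' x) \<le> ereal (b + e)"
    by (rule approximatesE[OF assms(2,3) U(2,3)]) blast
  show thesis
    by (rule that[of V a b]) (use U V a b in \<open>auto dest!: subsetD[OF V(1)]\<close>)
qed

text \<open>A failure at one point spreads: by \<open>hc_lower_ge_on_open\<close> there is a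
  nonempty open set on which \<open>f\<close> lies above \<open>d\<close> and \<open>f'\<close>
  below some \<open>c < d\<close>. There the approximations contradict
  \<open>g x \<le> g' x\<close>.\<close>

lemma approximates_le:
  assumes "approximates X g f" "approximates X g' f'" "\<And>x. x \<in> topspace X \<Longrightarrow> g x \<le> g' x"
  shows "ptwise_le X f f'"
proof (rule ptwise_le_if_lower_le)
  show hc: "hausdorff_continuous X f" "hausdorff_continuous X f'"
    using assms by (auto simp: approximates_def H_nf_hc)
  fix x assume x: "x \<in> topspace X"
  show "lower (f x) \<le> lower (f' x)"
  proof (rule ccontr)
    assume "\<not> lower (f x) \<le> lower (f' x)"
    then obtain c d where cd: "lower (f' x) < ereal c" "ereal c < ereal d" "ereal d < lower (f x)"
      by (metis ereal_dense2 not_le)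
    let ?U = "{y \<in> topspace X. ereal d < lower (f y)}"
    have U: "openin X ?U" "x \<in> ?U"
      using openin_Int_greater[OF openin_topspace hc_lsc[OF hc(1)]] x cd by auto
    obtain y where y: "y \<in> ?U" "upper (f' y) < ereal c"
      using hc_lower_ge_on_open[OF hc(2) U(1) _ U(2), of "ereal c"] cd by force
    let ?W = "{y \<in> ?U. upper (f' y) < ereal c}"
    have W: "openin X ?W" "?W \<noteq> {}"
      using openin_Int_less[OF U(1) hc_usc[OF hc(2)]] y by auto
    \<comment> \<open>Four errors of size \<open>(d - c)/4\<close> lie between \<open>d\<close> and
      \<open>c\<close>: from \<open>lower f\<close> to \<open>a\<close>, from \<open>a\<close> to
      \<open>g\<close>, from \<open>g'\<close> to \<open>b\<close> and from \<open>b\<close> to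
      \<open>upper f'\<close>. The bounds by \<open>d\<close> and \<open>c\<close> are strict, hence
      the contradiction.\<close>
    obtain V a b where V: "V \<subseteq> ?W" "openin X V" "V \<noteq> {}"
      and a: "\<And>x. x \<in> V \<Longrightarrow> \<bar>g x - a\<bar> \<le> (d - c)/4" "\<And>x. x \<in> V \<Longrightarrow> upper (f x) \<le> ereal (a + (d - c)/4)"
      and b: "\<And>x. x \<in> V \<Longrightarrow> \<bar>g' x - b\<bar> \<le> (d - c)/4" "\<And>x. x \<in> V \<Longrightarrow> ereal (b - (d - c)/4) \<le> lower (f' x)"
      by (rule approximates2E[OF assms(1,2) _ W, of "(d - c)/4"]) (use cd(2) in auto)
    obtain z where z: "z \<in> V" using V(3) by blast
    then have z': "ereal d < lower (f z)" "upper (f' z) < ereal c" "z \<in> topspace X" using V by auto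
    have "ereal d < ereal (a + (d - c)/4)"
      using z'(1) lower_le_upper[of "f z"] a(2)[OF z] by (meson less_le_trans)
    moreover have "ereal (b - (d - c)/4) < ereal c"
      using z'(2) lower_le_upper[of "f' z"] b(2)[OF z] by (meson le_less_trans)
    moreover have "a - g z \<le> (d - c)/4" "g' z - b \<le> (d - c)/4"
      using a(1)[OF z] b(1)[OF z] by linarith+
    ultimately have "d < a + (d - c)/4" "b - (d - c)/4 < c" "a - g z \<le> (d - c)/4" "g' z - b \<le> (d - c)/4"
      by simp_all
    then show False
      using assms(3)[OF z'(3)] by argo
  qed
qed

lemma approximates_eqI:
  assumes "approximates X g f" "approximates X g' f'" "\<And>x. x \<in> topspace X \<Longrightarrow> g x = g' x"
  shows "f = f'"
proof (rule ptwise_le_antisym)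
  show "hausdorff_continuous X f" "hausdorff_continuous X f'"
    using assms by (simp_all add: H_nf_hc approximates_H_nf)
  show "ptwise_le X f f'" "ptwise_le X f' f"
    using approximates_le[OF assms(1,2)] approximates_le[OF assms(2,1)] assms(3) by simp_all
qed

text \<open>An order relation between \<open>f\<close> and \<open>f'\<close> says nothing about
  \<open>g\<close> and \<open>g'\<close> at bad points. Passing to the maximum enforces the
  inequality pointwise, so that \<open>approximates_le\<close> applies in later arguments about the
  order.\<close>

lemma approximates_max:
  assumes "approximates X g f" "approximates X g' f'" "ptwise_le X f f'"
  shows "approximates X (\<lambda>x. max (g x) (g' x)) f'"
  unfolding approximates_def
proof (intro conjI allI impI approximates_H_nf[OF assms(2)])
  fix e :: real assume e: "0 < e"
  show "densely X (\<lambda>V. \<exists>a. \<forall>x\<in>V. \<bar>max (g x) (g' x) - a\<bar> \<le> e \<and>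
      ereal (a - e) \<le> lower (f' x) \<and> upper (f' x) \<le> ereal (a + e))"
    unfolding densely_def
  proof (intro allI impI; elim conjE)
    fix W assume W: "openin X W" "W \<noteq> {}"
    \<comment> \<open>The ordered ends give \<open>a \<le> b + 2*e/3\<close>, and \<open>g\<close>
      may exceed \<open>a\<close> by another \<open>e/3\<close>.\<close>
    obtain V a b where V: "V \<subseteq> W" "openin X V" "V \<noteq> {}"
      and a: "\<And>x. x \<in> V \<Longrightarrow> \<bar>g x - a\<bar> \<le> e/3" "\<And>x. x \<in> V \<Longrightarrow> ereal (a - e/3) \<le> lower (f x)"
      and b: "\<And>x. x \<in> V \<Longrightarrow> \<bar>g' x - b\<bar> \<le> e/3" "\<And>x. x \<in> V \<Longrightarrow> ereal (b - e/3) \<le> lower (f' x)"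
        "\<And>x. x \<in> V \<Longrightarrow> upper (f' x) \<le> ereal (b + e/3)"
      by (rule approximates2E[OF assms(1,2) _ W, of "e/3"]) (use e in auto)
    have "\<bar>max (g x) (g' x) - b\<bar> \<le> e \<and>
        ereal (b - e) \<le> lower (f' x) \<and> upper (f' x) \<le> ereal (b + e)" if x: "x \<in> V" for x
    proof -
      have "x \<in> topspace X" using x V openin_subset by blast
      then have "lower (f x) \<le> lower (f' x)" using assms(3) by (simp add: ptwise_le_def)
      then have "ereal (a - e/3) \<le> ereal (b + e/3)"
        using a(2)[OF x] b(3)[OF x] lower_le_upper[of "f' x"] by (meson order_trans)
      moreover have "ereal (b - e) \<le> ereal (b - e/3)" "ereal (b + e/3) \<le> ereal (b + e)"
        using e by auto
      ultimately have "a \<le> b + 2 * (e/3)" "ereal (b - e) \<le> lower (f' x)" "upper (f' x) \<le> ereal (b + e)"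
        using order_trans[OF _ b(2)[OF x]] order_trans[OF b(3)[OF x]] by auto
      moreover from this have "\<bar>max (g x) (g' x) - b\<bar> \<le> e"
        using a(1)[OF x] b(1)[OF x] e by (auto simp: max_def abs_if split: if_splits)
      ultimately show ?thesis by blast
    qed
    with V show "\<exists>V\<subseteq>W. openin X V \<and> V \<noteq> {} \<and> (\<exists>a. \<forall>x\<in>V. \<bar>max (g x) (g' x) - a\<bar> \<le> e \<and>
      ereal (a - e) \<le> lower (f' x) \<and> upper (f' x) \<le> ereal (a + e))" by blast
  qed
qed

section \<open>The frame of regular open sets\<close>

text \<open>\<open>\<Squnion>\<close> chooses some least upper bound. Antisymmetry makes it unique,
  so exhibiting one evaluates the operation.\<close>

lemma (in partial_order) sup_eq_lub: "is_lub L s A \<Longrightarrow> \<Squnion> A = s"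
  unfolding sup_def by (rule some_equality) (auto intro: least_unique)

lemma (in partial_order) inf_eq_glb: "is_glb L i A \<Longrightarrow> \<Sqinter> A = i"
  unfolding inf_def by (rule some_equality) (auto intro: greatest_unique)

lemma (in partial_order) top_eq_greatest: "greatest L t (carrier L) \<Longrightarrow> \<top> = t"
  unfolding top_def by (rule some_equality) (auto intro: greatest_unique)

lemma (in partial_order) bottom_eq_least: "least L b (carrier L) \<Longrightarrow> \<bottom> = b"
  unfolding bottom_def by (rule some_equality) (auto intro: least_unique)

definition regularize :: "'a topology \<Rightarrow> 'a set \<Rightarrow> 'a set" where
  "regularize X A = X interior_of (X closure_of A)"

lemma openin_regularize: "openin X (regularize X A)"
  by (simp add: regularize_def)

lemma subset_regularize: "openin X A \<Longrightarrow> A \<subseteq> regularize X A"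
  unfolding regularize_def by (meson closure_of_subset interior_of_maximal openin_subset)

lemma regularize_mono: "A \<subseteq> B \<Longrightarrow> regularize X A \<subseteq> regularize X B"
  unfolding regularize_def by (intro interior_of_mono closure_of_mono)

lemma regularize_subset_closure: "regularize X A \<subseteq> X closure_of A"
  by (simp add: regularize_def interior_of_subset)

lemma regularize_idem: "regularize X (regularize X A) = regularize X A"
proof
  have "X closure_of (regularize X A) \<subseteq> X closure_of A"
    by (simp add: closure_of_minimal regularize_subset_closure)
  then show "regularize X (regularize X A) \<subseteq> regularize X A"
    unfolding regularize_def[of X "regularize X A"] by (simp add: regularize_def interior_of_mono)
qed (simp add: openin_regularize subset_regularize)

text \<open>Every point of \<open>A\<close> lies in the closure of \<open>B\<close>, since a
  neighbourhood cut down to \<open>A\<close> still meets \<open>B\<close>. This is how statements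
  about dense families of open sets become inclusions of regular open sets.\<close>

lemma regularize_leI:
  assumes "openin X A" "\<And>W. openin X W \<Longrightarrow> W \<noteq> {} \<Longrightarrow> W \<subseteq> A \<Longrightarrow> W \<inter> B \<noteq> {}"
  shows "regularize X A \<subseteq> regularize X B"
proof -
  have "A \<subseteq> X closure_of B"
  proof
    fix x assume x: "x \<in> A"
    have "\<exists>y\<in>B. y \<in> T" if T: "x \<in> T" "openin X T" for T
      using assms(2)[of "A \<inter> T"] assms(1) T x by blast
    then show "x \<in> X closure_of B"
      using x openin_subset[OF assms(1)] by (auto simp: in_closure_of)
  qed
  then have "X closure_of A \<subseteq> X closure_of B" by (simp add: closure_of_minimal)
  then show ?thesis unfolding regularize_def by (rule interior_of_mono)
qed

text \<open>An open set meeting the closure of \<open>A\<close> meets \<open>A\<close>. This is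
  applied to \<open>W\<close> and \<open>A\<close>, and then to the still open set
  \<open>W \<inter> A\<close> and \<open>B\<close>.\<close>

lemma regularize_Int:
  assumes "openin X A" "openin X B"
  shows "regularize X A \<inter> regularize X B = regularize X (A \<inter> B)"
proof
  have "regularize X A \<inter> regularize X B \<subseteq> regularize X (regularize X A \<inter> regularize X B)"
    by (simp add: openin_Int openin_regularize subset_regularize)
  also have "\<dots> \<subseteq> regularize X (A \<inter> B)"
  proof (rule regularize_leI)
    fix W assume W: "openin X W" "W \<noteq> {}" "W \<subseteq> regularize X A \<inter> regularize X B"
    then have "W \<inter> X closure_of A \<noteq> {}" using regularize_subset_closure by fast
    then have WA: "W \<inter> A \<noteq> {}" by (simp add: openin_Int_closure_of_eq_empty[OF W(1)])
    have "openin X (W \<inter> A)" using W assms by blast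
    moreover have "(W \<inter> A) \<inter> X closure_of B \<noteq> {}"
      using WA W(3) regularize_subset_closure by fast
    ultimately have "(W \<inter> A) \<inter> B \<noteq> {}" by (simp add: openin_Int_closure_of_eq_empty)
    then show "W \<inter> (A \<inter> B) \<noteq> {}" by (simp add: Int_assoc)
  qed (simp add: openin_Int openin_regularize)
  finally show "regularize X A \<inter> regularize X B \<subseteq> regularize X (A \<inter> B)" .
qed (simp add: regularize_mono)

text \<open>By monotonicity and idempotence, suprema of regular open sets can be computed before the
  members are regularized.\<close>

lemma regularize_Union:
  assumes "\<And>i. i \<in> I \<Longrightarrow> openin X (A i)"
  shows "regularize X (\<Union>i\<in>I. regularize X (A i)) = regularize X (\<Union>i\<in>I. A i)"
proof
  have "regularize X (A i) \<subseteq> regularize X (\<Union>i\<in>I. A i)" if "i \<in> I" for i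
    using that by (intro regularize_mono) blast
  then have "(\<Union>i\<in>I. regularize X (A i)) \<subseteq> regularize X (\<Union>i\<in>I. A i)" by blast
  then show "regularize X (\<Union>i\<in>I. regularize X (A i)) \<subseteq> regularize X (\<Union>i\<in>I. A i)"
    by (metis regularize_idem regularize_mono)
  show "regularize X (\<Union>i\<in>I. A i) \<subseteq> regularize X (\<Union>i\<in>I. regularize X (A i))"
    using subset_regularize assms by (intro regularize_mono) blast
qed

lemma carrier_regular_opens: "U \<in> carrier (regular_opens X) \<longleftrightarrow> openin X U \<and> regularize X U = U"
  by (simp add: regular_opens_def regularize_def)

lemma le_regular_opens: "U \<sqsubseteq>\<^bsub>regular_opens X\<^esub> V \<longleftrightarrow> U \<subseteq> V"
  by (simp add: regular_opens_def)

lemma regularize_in_carrier: "regularize X A \<in> carrier (regular_opens X)"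
  by (simp add: carrier_regular_opens openin_regularize regularize_idem)

lemma partial_order_regular_opens: "partial_order (regular_opens X)"
  by standard (auto simp: regular_opens_def)

lemma sup_regular_opens:
  assumes "A \<subseteq> carrier (regular_opens X)"
  shows "\<Squnion>\<^bsub>regular_opens X\<^esub> A = regularize X (\<Union>A)"
proof (rule partial_order.sup_eq_lub[OF partial_order_regular_opens], rule least_UpperI)
  have "openin X (\<Union>A)" using assms by (intro openin_Union) (auto simp: carrier_regular_opens)
  then show "x \<sqsubseteq>\<^bsub>regular_opens X\<^esub> regularize X (\<Union>A)" if "x \<in> A" for x
    using that subset_regularize by (fastforce simp: le_regular_opens)
  show "regularize X (\<Union>A) \<sqsubseteq>\<^bsub>regular_opens X\<^esub> y" if "y \<in> Upper (regular_opens X) A" for y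
  proof -
    have y: "y \<in> carrier (regular_opens X)" "\<Union>A \<subseteq> y"
      using that assms by (auto simp: Upper_def le_regular_opens)
    then show ?thesis
      using regularize_mono[OF y(2), of X] by (simp add: carrier_regular_opens le_regular_opens)
  qed
qed (simp_all add: assms regularize_in_carrier)

lemma meet_regular_opens:
  assumes "U \<in> carrier (regular_opens X)" "V \<in> carrier (regular_opens X)"
  shows "U \<sqinter>\<^bsub>regular_opens X\<^esub> V = U \<inter> V"
  unfolding meet_def
proof (rule partial_order.inf_eq_glb[OF partial_order_regular_opens], rule greatest_LowerI)
  show "U \<inter> V \<in> carrier (regular_opens X)"
    using assms regularize_Int[of X U V] by (auto simp: carrier_regular_opens)
qed (use assms in \<open>auto simp: le_regular_opens Lower_def\<close>)

lemma top_regular_opens: "\<top>\<^bsub>regular_opens X\<^esub> = topspace X"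
proof (rule partial_order.top_eq_greatest[OF partial_order_regular_opens])
  show "greatest (regular_opens X) (topspace X) (carrier (regular_opens X))"
    by (auto simp: greatest_def le_regular_opens carrier_regular_opens regularize_def
        dest: openin_subset[THEN subsetD])
qed

lemma bottom_regular_opens: "\<bottom>\<^bsub>regular_opens X\<^esub> = {}"
  by (rule partial_order.bottom_eq_least[OF partial_order_regular_opens])
     (auto simp: least_def le_regular_opens carrier_regular_opens regularize_def)

section \<open>The isomorphism in terms of approximating functions\<close>

text \<open>The open subsets on which \<open>g\<close> exceeds \<open>p\<close> by a positive margin; the margin makes the set insensitive
  to the small errors of an approximation, up to a nowhere dense set.\<close>

definition exceeding :: "'a topology \<Rightarrow> ('a \<Rightarrow> real) \<Rightarrow> real \<Rightarrow> 'a set" where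
  "exceeding X g p = \<Union>{W. openin X W \<and> (\<exists>h>0. \<forall>x\<in>W. p + h \<le> g x)}"

lemma openin_exceeding: "openin X (exceeding X g p)"
  unfolding exceeding_def by (rule openin_Union) blast

lemma subset_exceedingI:
  "openin X W \<Longrightarrow> 0 < h \<Longrightarrow> (\<And>x. x \<in> W \<Longrightarrow> p + h \<le> g x) \<Longrightarrow> W \<subseteq> exceeding X g p"
  unfolding exceeding_def by blast

text \<open>The margin varies over \<open>exceeding\<close>; intersecting with one member of the
  union makes it uniform.\<close>

lemma exceedingE:
  assumes "openin X W" "W \<noteq> {}" "W \<subseteq> exceeding X g p"
  obtains V h where "openin X V" "V \<noteq> {}" "V \<subseteq> W" "0 < h" "\<And>x. x \<in> V \<Longrightarrow> p + h \<le> g x"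
proof -
  obtain x where "x \<in> W" "x \<in> exceeding X g p" using assms by blast
  then obtain U h where U: "x \<in> U" "openin X U" "0 < h" "\<forall>x\<in>U. p + h \<le> g x"
    unfolding exceeding_def by blast
  show thesis
    by (rule that[of "W \<inter> U" h]) (use U \<open>x \<in> W\<close> assms(1) in auto)
qed

text \<open>\<open>g < q\<close> is read as \<open>- q < - g\<close>, so that sums and multiples are
  computed once, for \<open>exceeding\<close>.\<close>

definition fun_hom :: "'a topology \<Rightarrow> ('a \<Rightarrow> real) \<Rightarrow> real_gen \<Rightarrow> 'a set" where
  "fun_hom X g = (\<lambda>t. case t of
     Above p \<Rightarrow> regularize X (exceeding X g (of_rat p))
   | Below q \<Rightarrow> regularize X (exceeding X (\<lambda>x. - g x) (- of_rat q)))"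

text \<open>On a small set both ends of \<open>f\<close> and the function \<open>g\<close> are close
  to the same \<open>a\<close>, so a margin above \<open>p\<close> for one is a margin for the
  other.\<close>

lemma H_nf_iso_Above:
  assumes "approximates X g f"
  shows "H_nf_iso X f (Above p) = regularize X (exceeding X g (of_rat p))"
proof -
  let ?A = "{x \<in> topspace X. ereal (of_rat p) < lower (f x)}"
  note hc = H_nf_hc[OF approximates_H_nf[OF assms]]
  have A: "openin X ?A" by (rule openin_Int_greater[OF openin_topspace hc_lsc[OF hc]])
  have "regularize X ?A \<subseteq> regularize X (exceeding X g (of_rat p))"
  proof (rule regularize_leI[OF A])
    fix W assume W: "openin X W" "W \<noteq> {}" "W \<subseteq> ?A"
    then obtain x where x: "x \<in> W" "ereal (of_rat p) < lower (f x)" by blast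
    \<comment> \<open>\<open>p < lower f\<close> has no uniform margin on \<open>W\<close>;
      shrinking to \<open>d < lower f\<close> creates one. A third of \<open>d - p\<close> pays for
      the error of \<open>f\<close>, a third for that of \<open>g\<close>, and a third
      remains.\<close>
    obtain d where d: "ereal (of_rat p) < ereal d" "ereal d < lower (f x)"
      using ereal_dense2[OF x(2)] by blast
    let ?W = "{y \<in> W. ereal d < lower (f y)}"
    have W': "openin X ?W" "?W \<noteq> {}"
      using openin_Int_greater[OF W(1) hc_lsc[OF hc]] x d by auto
    obtain V a where V: "V \<subseteq> ?W" "openin X V" "V \<noteq> {}"
      and a: "\<And>x. x \<in> V \<Longrightarrow> \<bar>g x - a\<bar> \<le> (d - of_rat p)/3"
        "\<And>x. x \<in> V \<Longrightarrow> upper (f x) \<le> ereal (a + (d - of_rat p)/3)"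
      by (rule approximatesE[OF assms _ W', of "(d - of_rat p)/3"]) (use d in auto)
    have "of_rat p + (d - of_rat p)/3 \<le> g y" if y: "y \<in> V" for y
    proof -
      have "ereal d < lower (f y)" using y V by blast
      then have "ereal d < ereal (a + (d - of_rat p)/3)"
        using lower_le_upper[of "f y"] a(2)[OF y] by (meson less_le_trans)
      then have "d < a + (d - of_rat p)/3" by simp
      then show ?thesis using a(1)[OF y] unfolding abs_le_iff by argo
    qed
    then have "V \<subseteq> exceeding X g (of_rat p)"
      using V d by (intro subset_exceedingI[where h = "(d - of_rat p)/3"]) auto
    then show "W \<inter> exceeding X g (of_rat p) \<noteq> {}" using V by blast
  qed
  moreover have "regularize X (exceeding X g (of_rat p)) \<subseteq> regularize X ?A"
  proof (rule regularize_leI[OF openin_exceeding])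
    fix W assume "openin X W" "W \<noteq> {}" "W \<subseteq> exceeding X g (of_rat p)"
    then obtain U h where U: "openin X U" "U \<noteq> {}" "U \<subseteq> W" "0 < h" "\<And>x. x \<in> U \<Longrightarrow> of_rat p + h \<le> g x"
      by (rule exceedingE) blast
    obtain V a where V: "V \<subseteq> U" "openin X V" "V \<noteq> {}"
      and a: "\<And>x. x \<in> V \<Longrightarrow> \<bar>g x - a\<bar> \<le> h/3" "\<And>x. x \<in> V \<Longrightarrow> ereal (a - h/3) \<le> lower (f x)"
      by (rule approximatesE[OF assms _ U(1,2), of "h/3"]) (use U(4) in auto)
    obtain y where y: "y \<in> V" using V by blast
    then have "of_rat p + h \<le> g y" using U(5) V by blast
    then have "of_rat p < a - h/3" using a(1)[OF y] U(4) unfolding abs_le_iff by argo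
    then have "ereal (of_rat p) < ereal (a - h/3)" by simp
    also have "\<dots> \<le> lower (f y)" using a(2) y by blast
    finally have "y \<in> ?A" using y V openin_subset by blast
    then show "W \<inter> ?A \<noteq> {}" using y V U by blast
  qed
  ultimately show ?thesis
    unfolding H_nf_iso_def by (simp add: regularize_def)
qed

lemma H_nf_iso_Below:
  assumes "approximates X g f"
  shows "H_nf_iso X f (Below q) = regularize X (exceeding X (\<lambda>x. - g x) (- of_rat q))"
proof -
  let ?A = "{x \<in> topspace X. upper (f x) < ereal (of_rat q)}"
  let ?B = "exceeding X (\<lambda>x. - g x) (- of_rat q)"
  note hc = H_nf_hc[OF approximates_H_nf[OF assms]]
  have A: "openin X ?A" by (rule openin_Int_less[OF openin_topspace hc_usc[OF hc]])
  have "regularize X ?A \<subseteq> regularize X ?B"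
  proof (rule regularize_leI[OF A])
    fix W assume W: "openin X W" "W \<noteq> {}" "W \<subseteq> ?A"
    then obtain x where x: "x \<in> W" "upper (f x) < ereal (of_rat q)" by blast
    obtain d where d: "upper (f x) < ereal d" "ereal d < ereal (of_rat q)"
      using ereal_dense2[OF x(2)] by blast
    let ?W = "{y \<in> W. upper (f y) < ereal d}"
    have W': "openin X ?W" "?W \<noteq> {}"
      using openin_Int_less[OF W(1) hc_usc[OF hc]] x d by auto
    obtain V a where V: "V \<subseteq> ?W" "openin X V" "V \<noteq> {}"
      and a: "\<And>x. x \<in> V \<Longrightarrow> \<bar>g x - a\<bar> \<le> (of_rat q - d)/3"
        "\<And>x. x \<in> V \<Longrightarrow> ereal (a - (of_rat q - d)/3) \<le> lower (f x)"
      by (rule approximatesE[OF assms _ W', of "(of_rat q - d)/3"]) (use d in auto)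
    have "- of_rat q + (of_rat q - d)/3 \<le> - g y" if y: "y \<in> V" for y
    proof -
      have "upper (f y) < ereal d" using y V by blast
      then have "ereal (a - (of_rat q - d)/3) < ereal d"
        using lower_le_upper[of "f y"] a(2)[OF y] by (meson le_less_trans)
      then have "a - (of_rat q - d)/3 < d" by simp
      then show ?thesis using a(1)[OF y] unfolding abs_le_iff by argo
    qed
    then have "V \<subseteq> ?B"
      using V d by (intro subset_exceedingI[where h = "(of_rat q - d)/3"]) auto
    then show "W \<inter> ?B \<noteq> {}" using V by blast
  qed
  moreover have "regularize X ?B \<subseteq> regularize X ?A"
  proof (rule regularize_leI[OF openin_exceeding])
    fix W assume "openin X W" "W \<noteq> {}" "W \<subseteq> ?B"
    then obtain U h where U: "openin X U" "U \<noteq> {}" "U \<subseteq> W" "0 < h" "\<And>x. x \<in> U \<Longrightarrow> - of_rat q + h \<le> - g x"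
      by (rule exceedingE) blast
    obtain V a where V: "V \<subseteq> U" "openin X V" "V \<noteq> {}"
      and a: "\<And>x. x \<in> V \<Longrightarrow> \<bar>g x - a\<bar> \<le> h/3" "\<And>x. x \<in> V \<Longrightarrow> upper (f x) \<le> ereal (a + h/3)"
      by (rule approximatesE[OF assms _ U(1,2), of "h/3"]) (use U(4) in auto)
    obtain y where y: "y \<in> V" using V by blast
    then have "- of_rat q + h \<le> - g y" using U(5) V by blast
    then have "a + h/3 < of_rat q" using a(1)[OF y] U(4) unfolding abs_le_iff by argo
    moreover have "upper (f y) \<le> ereal (a + h/3)" using a(2) y by blast
    ultimately have "upper (f y) < ereal (of_rat q)" by (meson le_less_trans ereal_less_eq less_ereal.simps(1))
    then have "y \<in> ?A" using y V openin_subset by blast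
    then show "W \<inter> ?A \<noteq> {}" using y V U by blast
  qed
  ultimately show ?thesis
    unfolding H_nf_iso_def by (simp add: regularize_def)
qed

text \<open>From here on the frame side involves only \<open>g\<close>, whatever its values at bad
  points.\<close>

lemma H_nf_iso_eq_fun_hom: "approximates X g f \<Longrightarrow> H_nf_iso X f = fun_hom X g"
  by (rule ext) (simp add: fun_hom_def H_nf_iso_Above H_nf_iso_Below split: real_gen.split)

text \<open>Were \<open>lower f\<close> larger at some point, a rational \<open>p\<close> would
  separate the functions on an open \<open>?W\<close>. The inclusion puts \<open>?W\<close> into the
  closure of the set where \<open>p < lower f'\<close>, although \<open>upper f' < p\<close> on
  \<open>?W\<close>.\<close>

lemma le_if_H_nf_iso_le:
  assumes hc: "hausdorff_continuous X f" "hausdorff_continuous X f'"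
    and le: "\<And>p. H_nf_iso X f (Above p) \<subseteq> H_nf_iso X f' (Above p)"
  shows "ptwise_le X f f'"
proof (rule ptwise_le_if_lower_le[OF hc])
  fix x assume x: "x \<in> topspace X"
  show "lower (f x) \<le> lower (f' x)"
  proof (rule ccontr)
    assume "\<not> lower (f x) \<le> lower (f' x)"
    then obtain c d where cd: "lower (f' x) < ereal c" "ereal c < ereal d" "ereal d < lower (f x)"
      by (metis ereal_dense2 not_le)
    then obtain p where p: "c < of_rat p" "of_rat p < d" using of_rat_dense by auto
    let ?U = "{y \<in> topspace X. ereal (of_rat p) < lower (f y)}"
    let ?U' = "{y \<in> topspace X. ereal (of_rat p) < lower (f' y)}"
    have "ereal (of_rat p) < lower (f x)"
      by (rule less_trans[OF _ cd(3)]) (simp add: p)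
    then have U: "openin X ?U" "x \<in> ?U"
      using openin_Int_greater[OF openin_topspace hc_lsc[OF hc(1)]] x by auto
    obtain y where y: "y \<in> ?U" "upper (f' y) < ereal c"
      using hc_lower_ge_on_open[OF hc(2) U(1) _ U(2), of "ereal c"] cd by force
    let ?W = "{y \<in> ?U. upper (f' y) < ereal c}"
    have W: "openin X ?W" "?W \<noteq> {}"
      using openin_Int_less[OF U(1) hc_usc[OF hc(2)]] y by auto
    have "?U \<subseteq> regularize X ?U" by (rule subset_regularize[OF U(1)])
    also have "\<dots> \<subseteq> regularize X ?U'" using le[of p] by (simp add: H_nf_iso_def regularize_def)
    also have "\<dots> \<subseteq> X closure_of ?U'" by (rule regularize_subset_closure)
    finally have "?W \<inter> X closure_of ?U' \<noteq> {}" using W(2) by blast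
    then have "?W \<inter> ?U' \<noteq> {}" unfolding openin_Int_closure_of_eq_empty[OF W(1)] .
    then obtain z where "upper (f' z) < ereal c" "ereal (of_rat p) < lower (f' z)" by blast
    then have "ereal (of_rat p) < ereal c" using lower_le_upper[of "f' z"] by (meson less_trans less_le_trans)
    then show False using p by simp
  qed
qed

lemma inj_on_H_nf_iso: "inj_on (H_nf_iso X) (H_nf X)"
  by (rule inj_onI) (auto intro!: ptwise_le_antisym le_if_H_nf_iso_le H_nf_hc)

section \<open>Frame operations computed on approximating functions\<close>

lemma regularize_exceeding_add:
  assumes "tame X g" "tame X h"
  shows "regularize X (\<Union>r::rat. exceeding X g (of_rat r) \<inter> exceeding X h (p - of_rat r)) =
    regularize X (exceeding X (\<lambda>x. g x + h x) p)" (is "regularize X ?A = regularize X ?B")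
proof
  have "exceeding X g r \<inter> exceeding X h (p - r) \<subseteq> ?B" for r
  proof
    fix x assume "x \<in> exceeding X g r \<inter> exceeding X h (p - r)"
    then obtain U V d e where U: "openin X U" "x \<in> U" "0 < d" "\<forall>y\<in>U. r + d \<le> g y"
      and V: "openin X V" "x \<in> V" "0 < e" "\<forall>y\<in>V. p - r + e \<le> h y"
      unfolding exceeding_def by blast
    have "U \<inter> V \<subseteq> ?B"
    proof (rule subset_exceedingI)
      show "openin X (U \<inter> V)" "0 < d + e" using U V by auto
      fix y assume "y \<in> U \<inter> V"
      then have "r + d \<le> g y" "p - r + e \<le> h y" using U V by auto
      then show "p + (d + e) \<le> g y + h y" by linarith
    qed
    then show "x \<in> ?B" using U V by blast
  qed
  then show "regularize X ?A \<subseteq> regularize X ?B" by (intro regularize_mono) blast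
  \<comment> \<open>One rational \<open>r\<close> has to bound \<open>g\<close> while
    \<open>p - r\<close> bounds \<open>h\<close> on the same open set, so both functions must be
    nearly constant there.\<close>
  show "regularize X ?B \<subseteq> regularize X ?A"
  proof (rule regularize_leI[OF openin_exceeding])
    fix W assume "openin X W" "W \<noteq> {}" "W \<subseteq> ?B"
    then obtain U d where U: "openin X U" "U \<noteq> {}" "U \<subseteq> W" "0 < d"
      "\<And>x. x \<in> U \<Longrightarrow> p + d \<le> g x + h x"
      by (rule exceedingE) blast
    have d8: "0 < d/8" using U(4) by simp
    obtain V where V: "V \<subseteq> U" "openin X V" "V \<noteq> {}"
      and "\<exists>a b. \<forall>x\<in>V. \<bar>g x - a\<bar> \<le> d/8 \<and> \<bar>h x - b\<bar> \<le> d/8"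
      by (rule denselyE[OF densely_tame2[OF assms d8] U(1,2)])
    then obtain a b where ab: "\<And>x. x \<in> V \<Longrightarrow> \<bar>g x - a\<bar> \<le> d/8" "\<And>x. x \<in> V \<Longrightarrow> \<bar>h x - b\<bar> \<le> d/8"
      by blast
    obtain z where z: "z \<in> V" using V by blast
    have "p + d \<le> g z + h z" using U(5) z V by blast
    then have ab': "p + 3*d/4 \<le> a + b" using ab[OF z] unfolding abs_le_iff by argo
    \<comment> \<open>The functions stay within \<open>d/8\<close> of \<open>a\<close> and
      \<open>b\<close>, and \<open>a + b\<close> exceeds \<open>p\<close> by at least
      \<open>3*d/4\<close>. This window for \<open>r\<close> leaves a margin of \<open>d/8\<close>
      for \<open>g\<close> and of \<open>d/4\<close> for \<open>h\<close>.\<close>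
    have "a - 3*d/8 < a - d/4" using U(4) by simp
    then obtain r where r: "a - 3*d/8 < of_rat r" "of_rat r < a - d/4"
      using of_rat_dense by blast
    have "V \<subseteq> exceeding X g (of_rat r)"
    proof (rule subset_exceedingI[OF V(2) d8])
      fix y assume "y \<in> V"
      then show "of_rat r + d/8 \<le> g y" using ab(1)[of y] r unfolding abs_le_iff by argo
    qed
    moreover have "V \<subseteq> exceeding X h (p - of_rat r)"
    proof (rule subset_exceedingI[OF V(2) d8])
      fix y assume "y \<in> V"
      then show "p - of_rat r + d/8 \<le> h y" using ab(2)[of y] r ab' U(4) unfolding abs_le_iff by argo
    qed
    ultimately show "W \<inter> ?A \<noteq> {}" using V U by blast
  qed
qed

lemma sup_regularize:
  "\<Squnion>\<^bsub>regular_opens X\<^esub> {regularize X (F r) |r. P r} = regularize X (\<Union>r\<in>{r. P r}. regularize X (F r))"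
proof -
  have "\<Union>{regularize X (F r) |r. P r} = (\<Union>r\<in>{r. P r}. regularize X (F r))" by blast
  then show ?thesis by (subst sup_regular_opens) (auto simp: regularize_in_carrier)
qed

lemma sup_meet_exceeding:
  assumes "tame X g" "tame X h"
  shows "\<Squnion>\<^bsub>regular_opens X\<^esub> {regularize X (exceeding X g (of_rat r)) \<sqinter>\<^bsub>regular_opens X\<^esub>
      regularize X (exceeding X h (p - of_rat r)) |r::rat. True} =
    regularize X (exceeding X (\<lambda>x. g x + h x) p)"
proof -
  have "regularize X (exceeding X g (of_rat r)) \<sqinter>\<^bsub>regular_opens X\<^esub> regularize X (exceeding X h (p - of_rat r))
      = regularize X (exceeding X g (of_rat r) \<inter> exceeding X h (p - of_rat r))" for r
    by (simp add: meet_regular_opens regularize_in_carrier regularize_Int openin_exceeding)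
  then have "\<Squnion>\<^bsub>regular_opens X\<^esub> {regularize X (exceeding X g (of_rat r)) \<sqinter>\<^bsub>regular_opens X\<^esub>
      regularize X (exceeding X h (p - of_rat r)) |r::rat. True} =
    regularize X (\<Union>r::rat. regularize X (exceeding X g (of_rat r) \<inter> exceeding X h (p - of_rat r)))"
    using sup_regularize[of X "\<lambda>r. exceeding X g (of_rat r) \<inter> exceeding X h (p - of_rat r)" "\<lambda>_. True"]
    by simp
  also have "\<dots> = regularize X (\<Union>r::rat. exceeding X g (of_rat r) \<inter> exceeding X h (p - of_rat r))"
    by (rule regularize_Union) (simp add: openin_Int openin_exceeding)
  also have "\<dots> = regularize X (exceeding X (\<lambda>x. g x + h x) p)"
    by (rule regularize_exceeding_add[OF assms])
  finally show ?thesis .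
qed

lemma tame_uminus: "tame X g \<Longrightarrow> tame X (\<lambda>x. - g x)"
  using tame_scale[of X g "-1"] by simp

text \<open>Reindexing by \<open>- r\<close> turns suprema for \<open>Below\<close> into suprema for
  \<open>Above\<close> of the negated function.\<close>

lemma Collect_uminus_rat: "{F r |r::rat. P r} = {F (- r) |r. P (- r)}"
  by (auto, metis minus_minus)

lemma hom_add_fun_hom:
  assumes "tame X g" "tame X h"
  shows "hom_add (regular_opens X) (fun_hom X g) (fun_hom X h) = fun_hom X (\<lambda>x. g x + h x)"
proof
  fix t
  show "hom_add (regular_opens X) (fun_hom X g) (fun_hom X h) t = fun_hom X (\<lambda>x. g x + h x) t"
  proof (cases t)
    case (Above p)
    then show ?thesis
      using sup_meet_exceeding[OF assms] by (simp add: hom_add_def fun_hom_def of_rat_diff)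
  next
    case (Below q)
    have "\<Squnion>\<^bsub>regular_opens X\<^esub> {regularize X (exceeding X (\<lambda>x. - g x) (- of_rat r)) \<sqinter>\<^bsub>regular_opens X\<^esub>
      regularize X (exceeding X (\<lambda>x. - h x) (- of_rat (q - r))) |r::rat. True} =
      \<Squnion>\<^bsub>regular_opens X\<^esub> {regularize X (exceeding X (\<lambda>x. - g x) (of_rat r)) \<sqinter>\<^bsub>regular_opens X\<^esub>
      regularize X (exceeding X (\<lambda>x. - h x) (- of_rat q - of_rat r)) |r::rat. True}"
      by (subst Collect_uminus_rat) (simp add: of_rat_diff of_rat_minus of_rat_add)
    also have "\<dots> = regularize X (exceeding X (\<lambda>x. - g x + - h x) (- of_rat q))"
      by (rule sup_meet_exceeding[OF assms[THEN tame_uminus]])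
    finally show ?thesis
      using Below by (simp add: hom_add_def fun_hom_def)
  qed
qed

text \<open>With a single function no splitting occurs, so the sets agree already before
  regularization.\<close>

lemma exceeding_scale:
  assumes "0 < c"
  shows "(\<Union>r\<in>{r. c * of_rat r > p}. exceeding X g (of_rat r)) = exceeding X (\<lambda>x. c * g x) p"
proof
  have "exceeding X g (of_rat r) \<subseteq> exceeding X (\<lambda>x. c * g x) p" if "p < c * of_rat r" for r
  proof
    fix x assume "x \<in> exceeding X g (of_rat r)"
    then obtain U d where U: "openin X U" "x \<in> U" "0 < d" "\<And>y. y \<in> U \<Longrightarrow> of_rat r + d \<le> g y"
      unfolding exceeding_def by blast
    have "U \<subseteq> exceeding X (\<lambda>x. c * g x) p"
    proof (rule subset_exceedingI[OF U(1)])
      show "0 < c * d" using assms U by simp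
      fix y assume "y \<in> U"
      then have "c * (of_rat r + d) \<le> c * g y" using U(4) assms by (intro mult_left_mono) auto
      then show "p + c * d \<le> c * g y" using that by (simp add: distrib_left)
    qed
    then show "x \<in> exceeding X (\<lambda>x. c * g x) p" using U by blast
  qed
  then show "(\<Union>r\<in>{r. c * of_rat r > p}. exceeding X g (of_rat r)) \<subseteq> exceeding X (\<lambda>x. c * g x) p"
    by blast
  show "exceeding X (\<lambda>x. c * g x) p \<subseteq> (\<Union>r\<in>{r. c * of_rat r > p}. exceeding X g (of_rat r))"
  proof
    fix x assume "x \<in> exceeding X (\<lambda>x. c * g x) p"
    then obtain U d where U: "openin X U" "x \<in> U" "0 < d" "\<And>y. y \<in> U \<Longrightarrow> p + d \<le> c * g y"
      unfolding exceeding_def by blast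
    \<comment> \<open>Half of the margin makes room for \<open>r\<close>; the other half, divided by
      \<open>c\<close>, remains as margin for \<open>g\<close>.\<close>
    have "p / c < (p + d/2) / c" using assms U(3) by (simp add: divide_strict_right_mono)
    then obtain r where r: "p / c < of_rat r" "of_rat r < (p + d/2) / c"
      using of_rat_dense by blast
    have "U \<subseteq> exceeding X g (of_rat r)"
    proof (rule subset_exceedingI[OF U(1)])
      show "0 < d / 2 / c" using assms U(3) by simp
      fix y assume "y \<in> U"
      have "of_rat r + d / 2 / c \<le> (p + d/2) / c + d / 2 / c" using r by simp
      also have "\<dots> = (p + d) / c" by (simp add: add_divide_distrib)
      also have "\<dots> \<le> g y"
        using U(4)[OF \<open>y \<in> U\<close>] assms by (simp add: pos_divide_le_eq mult.commute)
      finally show "of_rat r + d / 2 / c \<le> g y" .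
    qed
    moreover have "p < c * of_rat r" using r(1) assms by (simp add: pos_divide_less_eq mult.commute)
    ultimately show "x \<in> (\<Union>r\<in>{r. c * of_rat r > p}. exceeding X g (of_rat r))" using U(2) by blast
  qed
qed

lemma sup_exceeding_scale:
  assumes "0 < c"
  shows "\<Squnion>\<^bsub>regular_opens X\<^esub> {regularize X (exceeding X g (of_rat r)) |r. c * of_rat r > p} =
    regularize X (exceeding X (\<lambda>x. c * g x) p)"
  unfolding sup_regularize by (simp add: regularize_Union openin_exceeding exceeding_scale[OF assms])

lemma hom_scale_pos_fun_hom:
  assumes "0 < c"
  shows "hom_scale_pos (regular_opens X) c (fun_hom X g) = fun_hom X (\<lambda>x. c * g x)"
proof
  fix t
  show "hom_scale_pos (regular_opens X) c (fun_hom X g) t = fun_hom X (\<lambda>x. c * g x) t"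
  proof (cases t)
    case (Above p)
    then show ?thesis
      using sup_exceeding_scale[OF assms] by (simp add: hom_scale_pos_def fun_hom_def)
  next
    case (Below q)
    have "\<Squnion>\<^bsub>regular_opens X\<^esub> {regularize X (exceeding X (\<lambda>x. - g x) (- of_rat r)) |r. c * of_rat r < of_rat q} =
      \<Squnion>\<^bsub>regular_opens X\<^esub> {regularize X (exceeding X (\<lambda>x. - g x) (of_rat r)) |r. c * of_rat r > - of_rat q}"
      by (subst Collect_uminus_rat) (simp add: of_rat_minus)
    also have "\<dots> = regularize X (exceeding X (\<lambda>x. c * - g x) (- of_rat q))"
      by (rule sup_exceeding_scale[OF assms])
    finally show ?thesis
      using Below by (simp add: hom_scale_pos_def fun_hom_def)
  qed
qed

lemma hom_minus_fun_hom: "hom_minus (fun_hom X g) = fun_hom X (\<lambda>x. - g x)"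
  by (rule ext) (simp add: hom_minus_def fun_hom_def of_rat_minus split: real_gen.split)

lemma exceeding_zero: "exceeding X (\<lambda>x. 0) p = (if p < 0 then topspace X else {})"
proof (cases "p < 0")
  case True
  then have "topspace X \<subseteq> exceeding X (\<lambda>x. 0) p"
    by (intro subset_exceedingI[where h = "-p"]) auto
  then show ?thesis using True openin_subset[OF openin_exceeding[of X "\<lambda>x. 0" p]] by auto
next
  case False
  then show ?thesis unfolding exceeding_def by (force simp: add_nonneg_pos)
qed

lemma hom_zero_fun_hom: "hom_zero (regular_opens X) = fun_hom X (\<lambda>x. 0)"
  by (rule ext) (simp add: hom_zero_def fun_hom_def exceeding_zero top_regular_opens
    bottom_regular_opens regularize_def split: real_gen.split)

lemma hom_scale_fun_hom: "hom_scale (regular_opens X) c (fun_hom X g) = fun_hom X (\<lambda>x. c * g x)"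
proof -
  consider "0 < c" | "c = 0" | "0 < - c" by linarith
  then show ?thesis
    by cases (simp_all add: hom_scale_def hom_scale_pos_fun_hom hom_zero_fun_hom hom_minus_fun_hom)
qed

section \<open>The Riesz space of nearly finite Hausdorff continuous functions\<close>

text \<open>\<open>inv_into\<close> is evaluated by injectivity and an explicit preimage, the hull
  of \<open>g\<close>.\<close>

lemma approximates_inv_iso:
  assumes "tame X g"
  shows "approximates X g (inv_into (H_nf X) (H_nf_iso X) (fun_hom X g))"
proof -
  let ?f = "hc_hull X (\<lambda>x. ereal (g x))"
  have a: "approximates X g ?f" by (rule approximates_hc_hull[OF assms])
  then have "inv_into (H_nf X) (H_nf_iso X) (fun_hom X g) = ?f"
    by (metis H_nf_iso_eq_fun_hom approximates_H_nf inj_on_H_nf_iso inv_into_f_f)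
  with a show ?thesis by simp
qed

lemma carrier_H_nf: "carrier (H_nf_riesz X) = H_nf X"
  and le_H_nf: "f \<sqsubseteq>\<^bsub>H_nf_riesz X\<^esub> f' \<longleftrightarrow> ptwise_le X f f'"
  and eq_H_nf: "f .=\<^bsub>H_nf_riesz X\<^esub> f' \<longleftrightarrow> f = f'"
  by (simp_all add: H_nf_riesz_def Let_def)

lemma approximates_vadd:
  assumes "approximates X g f" "approximates X g' f'"
  shows "approximates X (\<lambda>x. g x + g' x) (vadd (H_nf_riesz X) f f')"
  using approximates_inv_iso[OF tame_add[OF assms[THEN approximates_imp_tame]]]
  by (simp add: H_nf_riesz_def Let_def frame_C_def H_nf_iso_eq_fun_hom[OF assms(1)]
    H_nf_iso_eq_fun_hom[OF assms(2)] hom_add_fun_hom assms[THEN approximates_imp_tame])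

lemma approximates_vscale:
  assumes "approximates X g f"
  shows "approximates X (\<lambda>x. c * g x) (vscale (H_nf_riesz X) c f)"
  using approximates_inv_iso[OF tame_scale[OF assms[THEN approximates_imp_tame], of c]]
  by (simp add: H_nf_riesz_def Let_def frame_C_def H_nf_iso_eq_fun_hom[OF assms] hom_scale_fun_hom)

lemma approximates_vzero: "approximates X (\<lambda>x. 0) (vzero (H_nf_riesz X))"
  using approximates_inv_iso[OF tame_const, of X 0]
  by (simp add: H_nf_riesz_def Let_def frame_C_def hom_zero_fun_hom)

lemma vscale_minus_one_twice:
  assumes "f \<in> H_nf X"
  shows "vscale (H_nf_riesz X) (-1) (vscale (H_nf_riesz X) (-1) f) = f"
  using approximates_vscale[OF approximates_vscale[OF approximates_real_lower[OF assms]], of "-1" "-1"]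
  by (rule approximates_eqI[OF _ approximates_real_lower[OF assms]]) simp

lemma vscale_minus_one_antimono:
  assumes "f \<in> H_nf X" "f' \<in> H_nf X" "ptwise_le X f f'"
  shows "ptwise_le X (vscale (H_nf_riesz X) (-1) f') (vscale (H_nf_riesz X) (-1) f)"
proof -
  note a = assms(1,2)[THEN approximates_real_lower]
  show ?thesis
    by (rule approximates_le[OF approximates_vscale[OF approximates_max[OF a assms(3)]]
      approximates_vscale[OF a(1)]]) simp
qed

text \<open>Multiplication by \<open>-1\<close> is an order reversing involution of
  \<open>H_nf X\<close>, which makes this the dual of \<open>approximates_max\<close>.\<close>

lemma approximates_min:
  assumes "approximates X g f" "approximates X g' f'" "ptwise_le X f f'"
  shows "approximates X (\<lambda>x. min (g x) (g' x)) f"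
proof -
  have f: "f \<in> H_nf X" "f' \<in> H_nf X" using assms approximates_H_nf by auto
  have "approximates X (\<lambda>x. -1 * max (-1 * g' x) (-1 * g x))
      (vscale (H_nf_riesz X) (-1) (vscale (H_nf_riesz X) (-1) f))"
    by (intro approximates_vscale
      approximates_max[OF assms(2,1)[THEN approximates_vscale] vscale_minus_one_antimono[OF f assms(3)]])
  moreover have "-1 * max (-1 * a) (-1 * b) = min b a" for a b :: real by (simp add: max_def min_def)
  ultimately show ?thesis by (simp add: vscale_minus_one_twice f)
qed

section \<open>Lattice operations and the Riesz space axioms\<close>

lemma tame_max:
  assumes "tame X g" "tame X h"
  shows "tame X (\<lambda>x. max (g x) (h x))"
  unfolding tame_def
proof (intro allI impI)
  fix e :: real assume e: "0 < e"
  show "densely X (\<lambda>V. \<exists>a. \<forall>x\<in>V. \<bar>max (g x) (h x) - a\<bar> \<le> e)"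
  proof (rule densely_mono[OF densely_tame2[OF assms e]], elim exE)
    fix V a b assume "\<forall>x\<in>V. \<bar>g x - a\<bar> \<le> e \<and> \<bar>h x - b\<bar> \<le> e"
    then have "\<forall>x\<in>V. \<bar>max (g x) (h x) - max a b\<bar> \<le> e"
      by (auto simp: abs_le_iff max_def)
    then show "\<exists>c. \<forall>x\<in>V. \<bar>max (g x) (h x) - c\<bar> \<le> e" by blast
  qed
qed

lemma tame_min:
  assumes "tame X g" "tame X h"
  shows "tame X (\<lambda>x. min (g x) (h x))"
proof -
  have "(\<lambda>x. min (g x) (h x)) = (\<lambda>x. - max (- g x) (- h x))"
    by (simp add: fun_eq_iff max_def min_def)
  then show ?thesis using assms by (simp add: tame_uminus tame_max)
qed

text \<open>Two uses of \<open>approximates_max\<close> give an upper bound \<open>y\<close> an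
  approximating function above both \<open>g\<close> and \<open>g'\<close>; the comparison with
  \<open>k\<close> is then pointwise.\<close>

lemma is_lub_max:
  assumes "approximates X g f" "approximates X g' f'" "approximates X (\<lambda>x. max (g x) (g' x)) k"
  shows "is_lub (H_nf_riesz X) k {f, f'}"
proof (rule least_UpperI)
  show "x \<sqsubseteq>\<^bsub>H_nf_riesz X\<^esub> k" if "x \<in> {f, f'}" for x
    using that approximates_le[OF assms(1,3)] approximates_le[OF assms(2,3)] by (auto simp: le_H_nf)
  show "k \<sqsubseteq>\<^bsub>H_nf_riesz X\<^esub> y" if "y \<in> Upper (H_nf_riesz X) {f, f'}" for y
  proof -
    have y: "y \<in> H_nf X" "ptwise_le X f y" "ptwise_le X f' y"
      using that assms(1,2)[THEN approximates_H_nf] by (auto simp: Upper_def carrier_H_nf le_H_nf)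
    show ?thesis unfolding le_H_nf
      by (rule approximates_le[OF assms(3) approximates_max[OF assms(1)
        approximates_max[OF assms(2) approximates_real_lower[OF y(1)] y(3)] y(2)]]) simp
  qed
qed (use assms[THEN approximates_H_nf] in \<open>simp_all add: carrier_H_nf\<close>)

lemma is_glb_min:
  assumes "approximates X g f" "approximates X g' f'" "approximates X (\<lambda>x. min (g x) (g' x)) k"
  shows "is_glb (H_nf_riesz X) k {f, f'}"
proof (rule greatest_LowerI)
  show "k \<sqsubseteq>\<^bsub>H_nf_riesz X\<^esub> x" if "x \<in> {f, f'}" for x
    using that approximates_le[OF assms(3,1)] approximates_le[OF assms(3,2)] by (auto simp: le_H_nf)
  show "y \<sqsubseteq>\<^bsub>H_nf_riesz X\<^esub> k" if "y \<in> Lower (H_nf_riesz X) {f, f'}" for y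
  proof -
    have y: "y \<in> H_nf X" "ptwise_le X y f" "ptwise_le X y f'"
      using that assms(1,2)[THEN approximates_H_nf] by (auto simp: Lower_def carrier_H_nf le_H_nf)
    show ?thesis unfolding le_H_nf
      by (rule approximates_le[OF approximates_min[OF approximates_min[OF
        approximates_real_lower[OF y(1)] assms(1) y(2)] assms(2) y(3)] assms(3)]) simp
  qed
qed (use assms[THEN approximates_H_nf] in \<open>simp_all add: carrier_H_nf\<close>)

lemma partial_order_H_nf: "partial_order (H_nf_riesz X)"
proof
  fix f f' assume "f \<sqsubseteq>\<^bsub>H_nf_riesz X\<^esub> f'" "f' \<sqsubseteq>\<^bsub>H_nf_riesz X\<^esub> f"
    "f \<in> carrier (H_nf_riesz X)" "f' \<in> carrier (H_nf_riesz X)"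
  then show "f .=\<^bsub>H_nf_riesz X\<^esub> f'"
    unfolding le_H_nf eq_H_nf carrier_H_nf by (intro ptwise_le_antisym H_nf_hc)
next
  fix f f' f'' assume "f \<sqsubseteq>\<^bsub>H_nf_riesz X\<^esub> f'" "f' \<sqsubseteq>\<^bsub>H_nf_riesz X\<^esub> f''"
  then show "f \<sqsubseteq>\<^bsub>H_nf_riesz X\<^esub> f''" by (auto simp: le_H_nf intro: ptwise_le_trans)
qed (auto simp: eq_H_nf le_H_nf ptwise_le_def fun_eq_iff)

lemma comm_group_H_nf:
  "comm_group \<lparr>carrier = carrier (H_nf_riesz X), mult = vadd (H_nf_riesz X), one = vzero (H_nf_riesz X)\<rparr>"
proof (rule comm_groupI; simp add: carrier_H_nf)
  note r = approximates_real_lower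
  show "vzero (H_nf_riesz X) \<in> H_nf X" by (rule approximates_H_nf[OF approximates_vzero])
  fix x assume x: "x \<in> H_nf X"
  show "vadd (H_nf_riesz X) (vzero (H_nf_riesz X)) x = x"
    by (rule approximates_eqI[OF approximates_vadd[OF approximates_vzero r[OF x]] r[OF x]]) simp
  show "\<exists>y\<in>H_nf X. vadd (H_nf_riesz X) y x = vzero (H_nf_riesz X)"
  proof
    show "vscale (H_nf_riesz X) (-1) x \<in> H_nf X" by (rule approximates_H_nf[OF approximates_vscale[OF r[OF x]]])
    show "vadd (H_nf_riesz X) (vscale (H_nf_riesz X) (-1) x) x = vzero (H_nf_riesz X)"
      by (rule approximates_eqI[OF approximates_vadd[OF approximates_vscale[OF r[OF x]] r[OF x]] approximates_vzero]) simp
  qed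
  fix y assume y: "y \<in> H_nf X"
  show "vadd (H_nf_riesz X) x y \<in> H_nf X"
    by (rule approximates_H_nf[OF approximates_vadd[OF r[OF x] r[OF y]]])
  show "vadd (H_nf_riesz X) x y = vadd (H_nf_riesz X) y x"
    by (rule approximates_eqI[OF approximates_vadd[OF r[OF x] r[OF y]] approximates_vadd[OF r[OF y] r[OF x]]]) simp
  fix z assume z: "z \<in> H_nf X"
  show "vadd (H_nf_riesz X) (vadd (H_nf_riesz X) x y) z = vadd (H_nf_riesz X) x (vadd (H_nf_riesz X) y z)"
    by (rule approximates_eqI[OF approximates_vadd[OF approximates_vadd[OF r[OF x] r[OF y]] r[OF z]]
      approximates_vadd[OF r[OF x] approximates_vadd[OF r[OF y] r[OF z]]]]) simp
qed

lemma riesz_space_H_nf: "riesz_space (H_nf_riesz X)"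
proof -
  interpret partial_order "H_nf_riesz X" by (rule partial_order_H_nf)
  note r = approximates_real_lower
  have "lattice (H_nf_riesz X)"
  proof (unfold_locales, goal_cases)
    case (1 x y)
    then have a: "approximates X (\<lambda>z. real_of_ereal (lower (x z))) x"
      "approximates X (\<lambda>z. real_of_ereal (lower (y z))) y" by (simp_all add: carrier_H_nf r)
    show ?case
      using is_lub_max[OF a approximates_hc_hull[OF tame_max[OF a[THEN approximates_imp_tame]]]] by blast
  next
    case (2 x y)
    then have a: "approximates X (\<lambda>z. real_of_ereal (lower (x z))) x"
      "approximates X (\<lambda>z. real_of_ereal (lower (y z))) y" by (simp_all add: carrier_H_nf r)
    show ?case
      using is_glb_min[OF a approximates_hc_hull[OF tame_min[OF a[THEN approximates_imp_tame]]]] by blast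
  qed
  then show ?thesis
  proof (intro riesz_space.intro riesz_space_axioms.intro, goal_cases)
    case 2
    show ?case by (rule comm_group_H_nf)
  next
    case (3 x c)
    then show ?case by (auto simp: carrier_H_nf intro!: approximates_H_nf approximates_vscale r)
  next
    case (4 x)
    then have x: "x \<in> H_nf X" by (simp add: carrier_H_nf)
    show ?case by (rule approximates_eqI[OF approximates_vscale[OF r[OF x]] r[OF x]]) simp
  next
    case (5 x c d)
    then have x: "x \<in> H_nf X" by (simp add: carrier_H_nf)
    show ?case
      by (rule approximates_eqI[OF approximates_vscale[OF approximates_vscale[OF r[OF x]]] approximates_vscale[OF r[OF x]]]) simp
  next
    case (6 x c d)
    then have x: "x \<in> H_nf X" by (simp add: carrier_H_nf)
    show ?case
      by (rule approximates_eqI[OF approximates_vscale[OF r[OF x]]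
        approximates_vadd[OF approximates_vscale[OF r[OF x]] approximates_vscale[OF r[OF x]]]]) (rule distrib_right)
  next
    case (7 x y c)
    then have x: "x \<in> H_nf X" and y: "y \<in> H_nf X" by (simp_all add: carrier_H_nf)
    show ?case
      by (rule approximates_eqI[OF approximates_vscale[OF approximates_vadd[OF r[OF x] r[OF y]]]
        approximates_vadd[OF approximates_vscale[OF r[OF x]] approximates_vscale[OF r[OF y]]]]) (rule distrib_left)
  next
    case (8 x y z)
    then have *: "x \<in> H_nf X" "y \<in> H_nf X" "z \<in> H_nf X" "ptwise_le X x y" by (simp_all add: carrier_H_nf le_H_nf)
    show ?case
      unfolding le_H_nf
      by (rule approximates_le[OF approximates_vadd[OF r[OF *(1)] r[OF *(3)]]
        approximates_vadd[OF approximates_max[OF r[OF *(1)] r[OF *(2)] *(4)] r[OF *(3)]]]) simp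
  next
    case (9 x c)
    then have *: "x \<in> H_nf X" "ptwise_le X (vzero (H_nf_riesz X)) x" "0 \<le> c" by (simp_all add: carrier_H_nf le_H_nf)
    show ?case
      unfolding le_H_nf
      by (rule approximates_le[OF approximates_vzero
        approximates_vscale[OF approximates_max[OF approximates_vzero r[OF *(1)] *(2)]]]) (simp add: *(3))
  qed assumption
qed

section \<open>Continuous functions as degenerate intervals\<close>

lemma approximates_continuous:
  assumes "continuous_map X euclideanreal g"
  shows "approximates X g (C_to_H_nf X g)"
proof -
  have lu: "lower (C_to_H_nf X g x) = ereal (g x)" "upper (C_to_H_nf X g x) = ereal (g x)"
    if "x \<in> topspace X" for x
    using that by (simp_all add: C_to_H_nf_def)
  have op: "openin X {x \<in> topspace X. a < g x}" "openin X {x \<in> topspace X. g x < a}" for a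
    using assms by (simp_all add: continuous_map_upper_lower_semicontinuous_lt)
  have "lsc_on X (\<lambda>x. ereal (g x))" "usc_on X (\<lambda>x. ereal (g x))"
    by (auto intro!: lsc_on_rat usc_on_rat op)
  moreover have "C_to_H_nf X g \<in> extensional (topspace X)" by (simp add: C_to_H_nf_def)
  ultimately have "C_to_H_nf X g \<in> interval_maps X"
    unfolding interval_maps_iff by (simp add: lsc_on_cong[OF lu(1)] usc_on_cong[OF lu(2)])
  \<comment> \<open>Both ends equal \<open>g\<close>, and the envelopes of \<open>g\<close> lie on
    the required sides of it.\<close>
  then have hc: "hausdorff_continuous X (C_to_H_nf X g)"
    by (rule hausdorff_continuousI)
      (auto simp: lu intro: order_trans[OF lsc_env_le] order_trans[OF _ usc_env_ge])
  have "\<exists>x\<in>W. lower (C_to_H_nf X g x) \<noteq> -\<infinity> \<and> upper (C_to_H_nf X g x) \<noteq> \<infinity>"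
    if "openin X W" "W \<noteq> {}" for W
  proof -
    obtain x where "x \<in> W" "x \<in> topspace X" using \<open>W \<noteq> {}\<close> openin_subset[OF \<open>openin X W\<close>] by blast
    then show ?thesis by (intro bexI[of _ x]) (simp_all add: lu)
  qed
  with hc have H: "C_to_H_nf X g \<in> H_nf X" unfolding H_nf_iff by blast
  show ?thesis
    unfolding approximates_def densely_def
  proof (intro conjI allI impI H; elim conjE)
    fix e :: real and W assume e: "0 < e" and W: "openin X W" "W \<noteq> {}"
    obtain x where x: "x \<in> W" "x \<in> topspace X" using W openin_subset by blast
    let ?V = "W \<inter> ({y \<in> topspace X. g x - e < g y} \<inter> {y \<in> topspace X. g y < g x + e})"
    have "openin X ?V" by (intro openin_Int W op)
    moreover have "x \<in> ?V" using x e by simp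
    moreover have "\<bar>g y - g x\<bar> \<le> e \<and> ereal (g x - e) \<le> lower (C_to_H_nf X g y) \<and>
      upper (C_to_H_nf X g y) \<le> ereal (g x + e)" if "y \<in> ?V" for y
      using that lu[of y] by auto
    ultimately show "\<exists>V\<subseteq>W. openin X V \<and> V \<noteq> {} \<and> (\<exists>a. \<forall>x\<in>V. \<bar>g x - a\<bar> \<le> e \<and>
      ereal (a - e) \<le> lower (C_to_H_nf X g x) \<and> upper (C_to_H_nf X g x) \<le> ereal (a + e))"
      by (intro exI[of _ ?V]) blast
  qed
qed

text \<open>Zero was defined as a preimage under the isomorphism; this gives access to its
  values.\<close>

lemma vzero_eq: "vzero (H_nf_riesz X) = C_to_H_nf X (\<lambda>x. 0)"
  by (rule approximates_eqI[OF approximates_vzero approximates_continuous]) simp_all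

lemma lower_vzero: "x \<in> topspace X \<Longrightarrow> lower (vzero (H_nf_riesz X) x) = 0"
  and upper_vzero: "x \<in> topspace X \<Longrightarrow> upper (vzero (H_nf_riesz X) x) = 0"
  by (simp_all add: vzero_eq C_to_H_nf_def)

text \<open>Any function between the two ends of \<open>f\<close> would serve in place of
  \<open>upper\<close>. Comparison with hulls settles both bounds, so each completeness proof only
  has to supply near finiteness.\<close>

lemma is_lub_hull_Sup:
  assumes "A \<subseteq> H_nf X" "hc_hull X (\<lambda>x. SUP f\<in>A. upper (f x)) \<in> H_nf X"
  shows "is_lub (H_nf_riesz X) (hc_hull X (\<lambda>x. SUP f\<in>A. upper (f x))) A"
proof (rule least_UpperI)
  show "f \<sqsubseteq>\<^bsub>H_nf_riesz X\<^esub> hc_hull X (\<lambda>x. SUP f\<in>A. upper (f x))" if "f \<in> A" for f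
    unfolding le_H_nf
  proof (rule hc_le_hull)
    show "hausdorff_continuous X f" using that assms H_nf_hc by blast
    show "lower (f x) \<le> (SUP f\<in>A. upper (f x))" for x
      using that by (intro SUP_upper2[of f]) auto
  qed
  show "hc_hull X (\<lambda>x. SUP f\<in>A. upper (f x)) \<sqsubseteq>\<^bsub>H_nf_riesz X\<^esub> u" if "u \<in> Upper (H_nf_riesz X) A" for u
  proof -
    have u: "u \<in> H_nf X" "\<And>f. f \<in> A \<Longrightarrow> ptwise_le X f u"
      using that assms(1) by (auto simp: Upper_def carrier_H_nf le_H_nf)
    show ?thesis
      unfolding le_H_nf
      by (rule hull_le_hc[OF H_nf_hc[OF u(1)]]) (use u(2) in \<open>auto simp: ptwise_le_def intro: SUP_least\<close>)
  qed
qed (use assms in \<open>simp_all add: carrier_H_nf\<close>)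

lemma dedekind_complete_H_nf: "dedekind_complete (H_nf_riesz X)"
  unfolding dedekind_complete_def carrier_H_nf
proof (intro allI impI; elim conjE)
  fix A assume A: "A \<subseteq> H_nf X" "A \<noteq> {}" "Upper (H_nf_riesz X) A \<noteq> {}"
  then obtain f u where f: "f \<in> A" and u: "u \<in> H_nf X" "\<And>f. f \<in> A \<Longrightarrow> ptwise_le X f u"
    by (auto simp: Upper_def carrier_H_nf le_H_nf)
  have fH: "f \<in> H_nf X" using f A by blast
  have "hc_hull X (\<lambda>x. SUP f\<in>A. upper (f x)) \<in> H_nf X"
  proof (rule H_nf_between[OF fH u(1) hausdorff_continuous_hull])
    show "ptwise_le X f (hc_hull X (\<lambda>x. SUP f\<in>A. upper (f x)))"
      by (rule hc_le_hull[OF H_nf_hc[OF fH]]) (use f in \<open>auto intro: SUP_upper2\<close>)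
    show "ptwise_le X (hc_hull X (\<lambda>x. SUP f\<in>A. upper (f x))) u"
      by (rule hull_le_hc[OF H_nf_hc[OF u(1)]]) (use u(2) in \<open>auto simp: ptwise_le_def intro: SUP_least\<close>)
  qed
  then show "\<exists>s. is_lub (H_nf_riesz X) s A" using is_lub_hull_Sup[OF A(1)] by blast
qed

text \<open>Disjointness is stated with absolute values. An approximating function of the form
  \<open>max 0\<close> makes \<open>- f \<le> f\<close> a pointwise fact.\<close>

lemma riesz_abs_nonneg:
  assumes "f \<in> H_nf X" "ptwise_le X (vzero (H_nf_riesz X)) f"
  shows "riesz_abs (H_nf_riesz X) f = f"
proof -
  have g: "approximates X (\<lambda>x. max 0 (real_of_ereal (lower (f x)))) f"
    by (rule approximates_max[OF approximates_vzero approximates_real_lower[OF assms(1)] assms(2)])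
  have "ptwise_le X (vscale (H_nf_riesz X) (-1) f) f"
    by (rule approximates_le[OF approximates_vscale[OF g] g]) simp
  then have "is_lub (H_nf_riesz X) f {f, vscale (H_nf_riesz X) (-1) f}"
    using assms(1) approximates_H_nf[OF approximates_vscale[OF g]]
    by (intro least_UpperI) (auto simp: le_H_nf carrier_H_nf Upper_def ptwise_le_def)
  then show ?thesis
    unfolding riesz_abs_def join_def by (rule partial_order.sup_eq_lub[OF partial_order_H_nf])
qed

text \<open>The hull \<open>?k\<close> of the step function with value \<open>d\<close> on
  \<open>V\<close> lies below both functions, hence below their meet, which is zero; yet
  \<open>?k\<close> is at least \<open>d\<close> on \<open>V\<close>.\<close>

lemma disjoint_not_both_positive:
  assumes f: "f \<in> H_nf X" "ptwise_le X (vzero (H_nf_riesz X)) f"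
    and f': "f' \<in> H_nf X" "ptwise_le X (vzero (H_nf_riesz X)) f'"
    and "riesz_disjoint (H_nf_riesz X) f f'"
    and V: "openin X V" "x \<in> V" and d: "0 < d"
      "\<And>y. y \<in> V \<Longrightarrow> ereal d \<le> upper (f y)" "\<And>y. y \<in> V \<Longrightarrow> ereal d \<le> upper (f' y)"
  shows False
proof -
  interpret riesz_space "H_nf_riesz X" by (rule riesz_space_H_nf)
  let ?z = "vzero (H_nf_riesz X)"
  let ?k = "hc_hull X (\<lambda>y. if y \<in> V then ereal d else 0)"
  have z: "?z \<in> H_nf X" by (rule approximates_H_nf[OF approximates_vzero])
  have up: "0 \<le> upper (f y)" "0 \<le> upper (f' y)" if "y \<in> topspace X" for y
    using that f f' upper_vzero[OF that] unfolding ptwise_le_def by fastforce+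
  have k: "ptwise_le X ?k f" "ptwise_le X ?k f'"
    using d up by (auto intro!: hull_le_hc H_nf_hc f f')
  \<comment> \<open>The meet bounds only members of \<open>H_nf X\<close>; \<open>?k\<close> is one
    because it lies between zero and \<open>f\<close>.\<close>
  have "ptwise_le X ?z ?k"
    using d(1) by (intro hc_le_hull H_nf_hc z) (auto simp: lower_vzero)
  then have kH: "?k \<in> H_nf X" by (rule H_nf_between[OF z f(1) hausdorff_continuous_hull _ k(1)])
  have "?k \<sqsubseteq>\<^bsub>H_nf_riesz X\<^esub> f \<sqinter>\<^bsub>H_nf_riesz X\<^esub> f'"
    using k kH f f' by (intro meet_le) (simp_all add: le_H_nf carrier_H_nf)
  also have "f \<sqinter>\<^bsub>H_nf_riesz X\<^esub> f' = ?z"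
    using assms(5) by (simp add: riesz_disjoint_def riesz_abs_nonneg f f')
  finally have "ptwise_le X ?k ?z" by (simp add: le_H_nf)
  moreover have x: "x \<in> topspace X" using V openin_subset by blast
  moreover have "ereal d \<le> lower (?k x)" by (rule hull_ge_on_open[OF V(1) _ V(2)]) simp
  ultimately show False using d(1) lower_vzero[OF x] unfolding ptwise_le_def
    by (metis ereal_less(2) leD order_trans)
qed

text \<open>With no upper bound given, near finiteness of the hull is the difficulty. In an open
  \<open>W\<close> either all members are at most 0, or some \<open>f\<close> is positive and
  bounded by a real on a smaller open set, where disjointness makes the other members
  vanish.\<close>

lemma laterally_complete_H_nf: "laterally_complete (H_nf_riesz X)"
  unfolding laterally_complete_def carrier_H_nf
proof (intro allI impI; elim conjE)
  fix A assume A: "A \<subseteq> H_nf X" "A \<noteq> {}" "\<forall>f\<in>A. vzero (H_nf_riesz X) \<sqsubseteq>\<^bsub>H_nf_riesz X\<^esub> f"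
    "pairwise (riesz_disjoint (H_nf_riesz X)) A"
  let ?s = "hc_hull X (\<lambda>x. SUP f\<in>A. upper (f x))"
  have pos: "ptwise_le X (vzero (H_nf_riesz X)) f" if "f \<in> A" for f
    using A(3) that by (simp add: le_H_nf)
  obtain f0 where f0: "f0 \<in> A" using A(2) by blast
  have "ptwise_le X f0 ?s"
    by (rule hc_le_hull[OF H_nf_hc]) (use f0 A(1) in \<open>auto intro: SUP_upper2\<close>)
  with pos[OF f0] have "ptwise_le X (vzero (H_nf_riesz X)) ?s" by (rule ptwise_le_trans)
  then have s0: "0 \<le> lower (?s x)" if "x \<in> topspace X" for x
    using that by (simp add: ptwise_le_def lower_vzero)
  have "?s \<in> H_nf X"
    unfolding H_nf_iff
  proof (intro conjI allI impI hausdorff_continuous_hull; elim conjE)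
    fix W assume W: "openin X W" "W \<noteq> {}"
    have "\<exists>x\<in>W. \<exists>M::real. upper (?s x) \<le> ereal M"
    proof (cases "\<forall>x\<in>W. \<forall>f\<in>A. upper (f x) \<le> 0")
      case True
      then have le: "upper (?s x) \<le> 0" if "x \<in> W" for x
        by (intro hull_le_on_open[OF W(1) _ that]) (auto intro!: SUP_least)
      obtain x where "x \<in> W" using W(2) by blast
      with le[of x] show ?thesis unfolding zero_ereal_def by blast
    next
      case False
      then obtain x f where xf: "x \<in> W" "f \<in> A" "0 < upper (f x)" by (meson not_le)
      then have fH: "f \<in> H_nf X" using A by blast
      note hc = H_nf_hc[OF fH]
      \<comment> \<open>A positive upper end forces a positive lower end somewhere in
        \<open>W\<close>, and the latter persists on an open set.\<close>
      obtain y where y: "y \<in> W" "0 < lower (f y)"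
        using hc_upper_le_on_open[OF hc W(1) _ xf(1), of 0] xf(3) by (meson not_le)
      obtain c where c: "0 < ereal c" "ereal c < lower (f y)" using ereal_dense2[OF y(2)] by blast
      let ?U = "{y \<in> W. ereal c < lower (f y)}"
      have U: "openin X ?U" "?U \<noteq> {}" using openin_Int_greater[OF W(1) hc_lsc[OF hc]] y c by auto
      then obtain z where z: "z \<in> ?U" "upper (f z) \<noteq> \<infinity>" using fH unfolding H_nf_iff by blast
      have "upper (f z) < \<infinity>" using z(2) by simp
      then obtain M where M: "upper (f z) < ereal M" using ereal_dense2 by blast
      let ?V = "{y \<in> ?U. upper (f y) < ereal M}"
      have V: "openin X ?V" "z \<in> ?V" using openin_Int_less[OF U(1) hc_usc[OF hc]] z M by auto
      have "upper (f' v) \<le> ereal M" if v: "v \<in> ?V" and f': "f' \<in> A" for f' v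
      proof (cases "f' = f")
        case True
        then show ?thesis using v by auto
      next
        case False
        then have dis: "riesz_disjoint (H_nf_riesz X) f f'"
          using A(4) xf(2) f' by (auto simp: pairwise_def)
        have f'H: "f' \<in> H_nf X" using f' A by blast
        \<comment> \<open>Otherwise both members would be at least \<open>min c d\<close> on a
          neighbourhood of \<open>t\<close>. The bound on the lower end then passes to the upper
          end.\<close>
        have "lower (f' t) \<le> 0" if t: "t \<in> ?V" for t
        proof (rule ccontr)
          assume "\<not> lower (f' t) \<le> 0"
          then obtain d where d: "0 < ereal d" "ereal d < lower (f' t)"
            using ereal_dense2[of 0] by (metis not_le)
          let ?T = "{y \<in> ?V. ereal d < lower (f' y)}"
          have T: "openin X ?T" "t \<in> ?T" using openin_Int_greater[OF V(1) hc_lsc[OF H_nf_hc[OF f'H]]] t d by auto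
          show False
          proof (rule disjoint_not_both_positive[OF fH pos[OF xf(2)] f'H pos[OF f'] dis T, of "min c d"])
            show "0 < min c d" using c d by simp
            fix y assume "y \<in> ?T"
            then have "ereal c < lower (f y)" "ereal d < lower (f' y)" by auto
            then have "ereal c \<le> upper (f y)" "ereal d \<le> upper (f' y)"
              using lower_le_upper[of "f y"] lower_le_upper[of "f' y"] by (meson less_imp_le order_trans)+
            then show "ereal (min c d) \<le> upper (f y)" "ereal (min c d) \<le> upper (f' y)"
              by (auto intro: order_trans[of _ "ereal c"] order_trans[of _ "ereal d"])
          qed
        qed
        then have "upper (f' v) \<le> 0"
          by (rule hc_upper_le_on_open[OF H_nf_hc[OF f'H] V(1) _ v])
        moreover have "0 < ereal M"
        proof -
          have "0 < ereal c" by (rule c(1))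
          also have "\<dots> < lower (f v)" using v by blast
          also have "\<dots> \<le> upper (f v)" by simp
          also have "\<dots> < ereal M" using v by blast
          finally show ?thesis .
        qed
        ultimately show ?thesis by (meson less_imp_le order_trans)
      qed
      then have "upper (?s z) \<le> ereal M"
        by (intro hull_le_on_open[OF V(1) _ V(2)] SUP_least)
      then show ?thesis using z by blast
    qed
    then obtain x M where "x \<in> W" "upper (?s x) \<le> ereal M" by blast
    moreover have "x \<in> topspace X" using \<open>x \<in> W\<close> W openin_subset by blast
    ultimately show "\<exists>x\<in>W. lower (?s x) \<noteq> -\<infinity> \<and> upper (?s x) \<noteq> \<infinity>"
      using s0[of x] by (intro bexI[of _ x]) auto
  qed
  then show "\<exists>s. is_lub (H_nf_riesz X) s A" using is_lub_hull_Sup[OF A(1)] by blast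
qed

section \<open>Embedding the continuous real functions\<close>

lemma carrier_C: "f \<in> carrier (C_riesz X) \<longleftrightarrow>
    f \<in> extensional (topspace X) \<and> continuous_map X euclideanreal f"
  and le_C: "f \<sqsubseteq>\<^bsub>C_riesz X\<^esub> g \<longleftrightarrow> (\<forall>x\<in>topspace X. f x \<le> g x)"
  and eq_C: "f .=\<^bsub>C_riesz X\<^esub> g \<longleftrightarrow> f = g"
  and vadd_C: "vadd (C_riesz X) f g = (\<lambda>x\<in>topspace X. f x + g x)"
  and vzero_C: "vzero (C_riesz X) = (\<lambda>x\<in>topspace X. 0)"
  and vscale_C: "vscale (C_riesz X) c f = (\<lambda>x\<in>topspace X. c * f x)"
  by (auto simp: C_riesz_def PiE_def)

lemma restrict_in_carrier_C:
  assumes "continuous_map X euclideanreal f"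
  shows "(\<lambda>x\<in>topspace X. f x) \<in> carrier (C_riesz X)"
  using continuous_map_eq[OF assms, of "\<lambda>x\<in>topspace X. f x"] by (simp add: carrier_C)

lemma partial_order_C: "partial_order (C_riesz X)"
proof
  fix f g assume "f \<sqsubseteq>\<^bsub>C_riesz X\<^esub> g" "g \<sqsubseteq>\<^bsub>C_riesz X\<^esub> f"
    "f \<in> carrier (C_riesz X)" "g \<in> carrier (C_riesz X)"
  then show "f .=\<^bsub>C_riesz X\<^esub> g"
    unfolding le_C eq_C carrier_C by (intro extensionalityI[of f "topspace X"]) (auto intro: antisym)
qed (auto simp: eq_C le_C fun_eq_iff intro: order_trans)

lemma is_lub_C:
  assumes "f \<in> carrier (C_riesz X)" "g \<in> carrier (C_riesz X)"
  shows "is_lub (C_riesz X) (\<lambda>x\<in>topspace X. max (f x) (g x)) {f, g}"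
proof (rule least_UpperI)
  show "(\<lambda>x\<in>topspace X. max (f x) (g x)) \<in> carrier (C_riesz X)"
    using assms by (intro restrict_in_carrier_C continuous_map_real_max) (simp_all add: carrier_C)
qed (use assms in \<open>auto simp: Upper_def le_C\<close>)

lemma is_glb_C:
  assumes "f \<in> carrier (C_riesz X)" "g \<in> carrier (C_riesz X)"
  shows "is_glb (C_riesz X) (\<lambda>x\<in>topspace X. min (f x) (g x)) {f, g}"
proof (rule greatest_LowerI)
  show "(\<lambda>x\<in>topspace X. min (f x) (g x)) \<in> carrier (C_riesz X)"
    using assms by (intro restrict_in_carrier_C continuous_map_real_min) (simp_all add: carrier_C)
qed (use assms in \<open>auto simp: Lower_def le_C\<close>)

lemma vadd_C_closed:
  "f \<in> carrier (C_riesz X) \<Longrightarrow> g \<in> carrier (C_riesz X) \<Longrightarrow> vadd (C_riesz X) f g \<in> carrier (C_riesz X)"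
  unfolding vadd_C by (intro restrict_in_carrier_C continuous_map_add) (simp_all add: carrier_C)

lemma vscale_C_closed: "f \<in> carrier (C_riesz X) \<Longrightarrow> vscale (C_riesz X) c f \<in> carrier (C_riesz X)"
  unfolding vscale_C by (intro restrict_in_carrier_C continuous_map_real_mult_left) (simp add: carrier_C)

lemma comm_group_C:
  "comm_group \<lparr>carrier = carrier (C_riesz X), mult = vadd (C_riesz X), one = vzero (C_riesz X)\<rparr>"
proof (rule comm_groupI, simp_all add: vadd_C_closed, goal_cases)
  case 1
  then show ?case unfolding vzero_C by (rule restrict_in_carrier_C) simp
next
  case (2 x y z)
  then show ?case by (simp add: vadd_C restrict_def fun_eq_iff add.assoc)
next
  case (3 x y)
  then show ?case by (simp add: vadd_C add.commute)
next
  case (4 x)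
  then show ?case
    by (intro extensionalityI[of _ "topspace X"]) (simp_all add: vadd_C vzero_C carrier_C)
next
  case (5 x)
  show ?case
  proof
    show "vscale (C_riesz X) (-1) x \<in> carrier (C_riesz X)" using 5 by (rule vscale_C_closed)
    show "vadd (C_riesz X) (vscale (C_riesz X) (-1) x) x = vzero (C_riesz X)"
      by (simp add: vadd_C vscale_C vzero_C fun_eq_iff restrict_def)
  qed
qed

lemma riesz_space_C: "riesz_space (C_riesz X)"
proof -
  interpret partial_order "C_riesz X" by (rule partial_order_C)
  have "lattice (C_riesz X)"
    by unfold_locales (use is_lub_C is_glb_C in blast)+
  then show ?thesis
  proof (intro riesz_space.intro riesz_space_axioms.intro, goal_cases)
    case 2
    show ?case by (rule comm_group_C)
  next
    case (3 x c)
    then show ?case by (simp add: vscale_C_closed)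
  next
    case (4 x)
    then show ?case by (intro extensionalityI[of _ "topspace X"]) (simp_all add: vscale_C carrier_C)
  qed (auto simp: vscale_C vadd_C vzero_C le_C restrict_def fun_eq_iff algebra_simps)
qed

lemma approximates_C: "f \<in> carrier (C_riesz X) \<Longrightarrow> approximates X f (C_to_H_nf X f)"
  by (simp add: approximates_continuous carrier_C)

lemma ptwise_le_C_to_H_nf:
  "ptwise_le X (C_to_H_nf X f) (C_to_H_nf X g) \<longleftrightarrow> (\<forall>x\<in>topspace X. f x \<le> g x)"
  by (simp add: ptwise_le_def C_to_H_nf_def)

text \<open>A continuous function approximates its own image, so each law compares equal
  approximating functions.\<close>

lemma riesz_embedding_C_to_H_nf: "riesz_embedding (C_riesz X) (H_nf_riesz X) (C_to_H_nf X)"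
  unfolding riesz_embedding_def
proof (intro conjI ballI allI)
  show "C_to_H_nf X \<in> carrier (C_riesz X) \<rightarrow> carrier (H_nf_riesz X)"
    by (auto simp: carrier_H_nf intro: approximates_H_nf approximates_C)
  show "inj_on (C_to_H_nf X) (carrier (C_riesz X))"
  proof (rule inj_onI)
    fix f g assume f: "f \<in> carrier (C_riesz X)" and g: "g \<in> carrier (C_riesz X)"
      and eq: "C_to_H_nf X f = C_to_H_nf X g"
    have "f x = g x" if "x \<in> topspace X" for x
    proof -
      have "lower (C_to_H_nf X f x) = lower (C_to_H_nf X g x)" by (simp add: eq)
      then show ?thesis using that by (simp add: C_to_H_nf_def)
    qed
    then show "f = g" using f g by (intro extensionalityI[of f "topspace X"]) (simp_all add: carrier_C)
  qed
next
  fix c f assume f: "f \<in> carrier (C_riesz X)"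
  show "C_to_H_nf X (vscale (C_riesz X) c f) = vscale (H_nf_riesz X) c (C_to_H_nf X f)"
    by (rule approximates_eqI[OF approximates_C[OF vscale_C_closed[OF f]] approximates_vscale[OF approximates_C[OF f]]])
      (simp add: vscale_C)
next
  fix f g assume f: "f \<in> carrier (C_riesz X)" and g: "g \<in> carrier (C_riesz X)"
  note a = approximates_C[OF f] approximates_C[OF g]
  show "C_to_H_nf X (vadd (C_riesz X) f g) = vadd (H_nf_riesz X) (C_to_H_nf X f) (C_to_H_nf X g)"
    by (rule approximates_eqI[OF approximates_C[OF vadd_C_closed[OF f g]] approximates_vadd[OF a]])
      (simp add: vadd_C)
  have cont: "continuous_map X euclideanreal (\<lambda>x. max (f x) (g x))"
    "continuous_map X euclideanreal (\<lambda>x. min (f x) (g x))"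
    using f g by (simp_all add: carrier_C continuous_map_real_max continuous_map_real_min)
  have C_eq: "C_to_H_nf X (\<lambda>x\<in>topspace X. h x) = C_to_H_nf X h" for h
    by (simp add: C_to_H_nf_def restrict_def fun_eq_iff)
  have "f \<squnion>\<^bsub>C_riesz X\<^esub> g = (\<lambda>x\<in>topspace X. max (f x) (g x))"
    unfolding join_def by (rule partial_order.sup_eq_lub[OF partial_order_C is_lub_C[OF f g]])
  moreover have "C_to_H_nf X f \<squnion>\<^bsub>H_nf_riesz X\<^esub> C_to_H_nf X g = C_to_H_nf X (\<lambda>x. max (f x) (g x))"
    unfolding join_def
    by (rule partial_order.sup_eq_lub[OF partial_order_H_nf is_lub_max[OF a approximates_continuous[OF cont(1)]]])
  ultimately show "C_to_H_nf X (f \<squnion>\<^bsub>C_riesz X\<^esub> g) = C_to_H_nf X f \<squnion>\<^bsub>H_nf_riesz X\<^esub> C_to_H_nf X g"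
    by (simp add: C_eq)
  have "f \<sqinter>\<^bsub>C_riesz X\<^esub> g = (\<lambda>x\<in>topspace X. min (f x) (g x))"
    unfolding meet_def by (rule partial_order.inf_eq_glb[OF partial_order_C is_glb_C[OF f g]])
  moreover have "C_to_H_nf X f \<sqinter>\<^bsub>H_nf_riesz X\<^esub> C_to_H_nf X g = C_to_H_nf X (\<lambda>x. min (f x) (g x))"
    unfolding meet_def
    by (rule partial_order.inf_eq_glb[OF partial_order_H_nf is_glb_min[OF a approximates_continuous[OF cont(2)]]])
  ultimately show "C_to_H_nf X (f \<sqinter>\<^bsub>C_riesz X\<^esub> g) = C_to_H_nf X f \<sqinter>\<^bsub>H_nf_riesz X\<^esub> C_to_H_nf X g"
    by (simp add: C_eq)
qed

section \<open>Order density of the continuous functions\<close>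

lemma completely_regular_bump:
  assumes "completely_regular_space X" "openin X U" "x \<in> U" "0 \<le> c"
  obtains g where "g \<in> carrier (C_riesz X)" "g x = c" "\<And>y. y \<in> topspace X \<Longrightarrow> 0 \<le> g y \<and> g y \<le> c"
    "\<And>y. y \<in> topspace X - U \<Longrightarrow> g y = 0"
proof -
  have "closedin X (topspace X - U)" "x \<in> topspace X - (topspace X - U)"
    using assms openin_subset by blast+
  then obtain f :: "'a \<Rightarrow> real" where f: "continuous_map X (top_of_set {0..1}) f" "f x = 0"
      "f ` (topspace X - U) \<subseteq> {1}"
    using assms(1) unfolding completely_regular_space_def by blast
  have f01: "0 \<le> f y" "f y \<le> 1" if "y \<in> topspace X" for y
    using f(1) that by (auto simp: continuous_map_in_subtopology)
  have "continuous_map X euclideanreal f" using f(1) by (simp add: continuous_map_in_subtopology)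
  \<comment> \<open>The separating function is 0 at \<open>x\<close> and 1 outside \<open>U\<close>;
    reversing and scaling it gives a bump of height \<open>c\<close>.\<close>
  then have cont: "continuous_map X euclideanreal (\<lambda>y. c * (1 - f y))"
    by (intro continuous_map_real_mult_left continuous_map_diff) simp_all
  have x: "x \<in> topspace X" using assms openin_subset by blast
  show thesis
  proof (rule that[OF restrict_in_carrier_C[OF cont]])
    fix y assume y: "y \<in> topspace X"
    have "c * (1 - f y) \<le> c * 1" using f01[OF y] assms(4) by (intro mult_left_mono) auto
    then show "0 \<le> (\<lambda>y\<in>topspace X. c * (1 - f y)) y \<and> (\<lambda>y\<in>topspace X. c * (1 - f y)) y \<le> c"
      using f01[OF y] assms(4) y by simp
  qed (use f x in auto)
qed

text \<open>If an upper bound \<open>u\<close> fell below \<open>f\<close> at \<open>x\<close>, some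
  \<open>c\<close> would lie between the lower ends. A bump of height \<open>c\<close> at
  \<open>x\<close>, vanishing off the set where \<open>c < lower f\<close>, lies below
  \<open>f\<close>, belongs to the family and forces \<open>c \<le> lower (u x)\<close>.\<close>

lemma is_lub_C_below:
  assumes "completely_regular_space X" and f: "f \<in> H_nf X" "ptwise_le X (vzero (H_nf_riesz X)) f"
  shows "is_lub (H_nf_riesz X) f {C_to_H_nf X g |g. g \<in> carrier (C_riesz X) \<and>
    vzero (H_nf_riesz X) \<sqsubseteq>\<^bsub>H_nf_riesz X\<^esub> C_to_H_nf X g \<and> C_to_H_nf X g \<sqsubseteq>\<^bsub>H_nf_riesz X\<^esub> f}"
    (is "is_lub _ _ ?A")
proof (rule least_UpperI)
  show A: "?A \<subseteq> carrier (H_nf_riesz X)"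
    by (auto simp: carrier_H_nf intro: approximates_H_nf approximates_C)
  fix u assume u: "u \<in> Upper (H_nf_riesz X) ?A"
  then have uH: "u \<in> H_nf X" by (simp add: Upper_def carrier_H_nf)
  have le_u: "g x \<le> lower (u x)"
    if g: "g \<in> carrier (C_riesz X)" "\<And>y. y \<in> topspace X \<Longrightarrow> 0 \<le> g y"
      "\<And>y. y \<in> topspace X \<Longrightarrow> ereal (g y) \<le> lower (f y)" and x: "x \<in> topspace X" for g x
  proof -
    have "vzero (H_nf_riesz X) \<sqsubseteq>\<^bsub>H_nf_riesz X\<^esub> C_to_H_nf X g"
      using g(2) by (simp add: le_H_nf vzero_eq ptwise_le_C_to_H_nf)
    moreover have "C_to_H_nf X g \<sqsubseteq>\<^bsub>H_nf_riesz X\<^esub> f"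
      using g(3) order_trans[OF g(3) lower_le_upper] by (simp add: le_H_nf ptwise_le_def C_to_H_nf_def)
    ultimately have "C_to_H_nf X g \<in> ?A" using g(1) by blast
    then have "ptwise_le X (C_to_H_nf X g) u" using u A by (auto simp: Upper_def le_H_nf)
    then show ?thesis using x by (simp add: ptwise_le_def C_to_H_nf_def)
  qed
  show "f \<sqsubseteq>\<^bsub>H_nf_riesz X\<^esub> u"
    unfolding le_H_nf
  proof (rule ptwise_le_if_lower_le[OF H_nf_hc[OF f(1)] H_nf_hc[OF uH]])
    fix x assume x: "x \<in> topspace X"
    have f0: "0 \<le> lower (f y)" if "y \<in> topspace X" for y
      using f(2) that by (simp add: ptwise_le_def lower_vzero)
    show "lower (f x) \<le> lower (u x)"
    proof (rule ccontr)
      assume "\<not> lower (f x) \<le> lower (u x)"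
      then obtain c where c: "lower (u x) < ereal c" "ereal c < lower (f x)"
        by (metis ereal_dense2 not_le)
      \<comment> \<open>The zero function belongs to the family, so \<open>u\<close> is nonnegative
        and \<open>c\<close> is an admissible height for a bump.\<close>
      have "vzero (C_riesz X) \<in> carrier (C_riesz X)"
        unfolding vzero_C by (rule restrict_in_carrier_C) simp
      then have "0 \<le> lower (u x)"
        using le_u[of "vzero (C_riesz X)" x] x f0 by (simp add: vzero_C zero_ereal_def)
      then have c0: "0 \<le> c" using c(1) by (metis ereal_less_eq(5) less_imp_le order_trans)
      have U: "openin X {y \<in> topspace X. ereal c < lower (f y)}" "x \<in> {y \<in> topspace X. ereal c < lower (f y)}"
        using openin_Int_greater[OF openin_topspace hc_lsc[OF H_nf_hc[OF f(1)]]] x c by auto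
      obtain g where g: "g \<in> carrier (C_riesz X)" "g x = c"
        "\<And>y. y \<in> topspace X \<Longrightarrow> 0 \<le> g y \<and> g y \<le> c"
        "\<And>y. y \<in> topspace X - {y \<in> topspace X. ereal c < lower (f y)} \<Longrightarrow> g y = 0"
        by (rule completely_regular_bump[OF assms(1) U c0]) blast
      have "ereal (g y) \<le> lower (f y)" if y: "y \<in> topspace X" for y
      proof (cases "ereal c < lower (f y)")
        case True
        have "ereal (g y) \<le> ereal c" using g(3)[OF y] by simp
        with True show ?thesis by (meson less_imp_le order_trans)
      next
        case False
        then show ?thesis using g(4)[of y] y f0[OF y] by (simp add: zero_ereal_def)
      qed
      then have "ereal c \<le> lower (u x)" using le_u[OF g(1) _ _ x] g(2,3) by simp
      then show False using c(1) by simp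
    qed
  qed
qed (use f in \<open>auto simp: carrier_H_nf\<close>)

theorem theorem6p3:
  fixes X :: "'a topology"
  assumes "completely_regular_space X"
  shows "universal_completion (C_riesz X) (H_nf_riesz X) (C_to_H_nf X)"
  unfolding universal_completion_def universally_complete_def
proof (intro conjI ballI impI)
  fix f assume "f \<in> carrier (H_nf_riesz X)" "vzero (H_nf_riesz X) \<sqsubseteq>\<^bsub>H_nf_riesz X\<^esub> f"
  then show "is_lub (H_nf_riesz X) f {C_to_H_nf X g |g. g \<in> carrier (C_riesz X) \<and>
    vzero (H_nf_riesz X) \<sqsubseteq>\<^bsub>H_nf_riesz X\<^esub> C_to_H_nf X g \<and> C_to_H_nf X g \<sqsubseteq>\<^bsub>H_nf_riesz X\<^esub> f}"
    by (intro is_lub_C_below[OF assms]) (simp_all add: carrier_H_nf le_H_nf)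
qed (rule riesz_space_C riesz_space_H_nf dedekind_complete_H_nf laterally_complete_H_nf
  riesz_embedding_C_to_H_nf)+

end
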